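(* Let $\mathcal R$ be a protocol model with roles indexed by $i$, and for each role $i$ and run identifier $\mathit{rid}$ let $c_i(\mathit{rid})$ be a program (possibly containing protocol-independent I/O operations) with concrete labeled transition system $\mathscr C_i(\mathit{rid})$ and let $\psi_i(\mathit{rid})$ be the I/O specification of role $i$. Suppose that the verifier assumption (VA) of the context holds, that the taint analysis succeeds on each $c_i(\mathit{rid})$, and that for each role $i$ the Hoare triple $\vdash_{\pi'_{\mathrm{ext}}}\{\psi_i(\mathit{rid})\}\,c_i(\mathit{rid})\,\{\mathsf{true}\}$ has been verified. Then $$\Bigl(\big|\big|\big|_{i,\mathit{rid}}\ \pi_{\mathrm{int}}(\mathscr C_i(\mathit{rid}))\Bigr)\parallel_{\chi'}\mathscr E\ \preccurlyeq_t\ \mathcal R .$$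
   Context: Transition systems. A multiset rewriting (MSR) system over a term signature $\Sigma$ has rules $\ell\xrightarrow{a}r$ ($\ell,r$ multisets of facts, $a$ a label); states are multisets of facts, initially empty; an instance of a rule applies if $\ell$ is included in the state, removes the linear facts of $\ell$ (persistent facts are never consumed and their multiplicity is irrelevant), adds $r$, and emits label $a$ (possibly empty, $[\,]$). $\preccurlyeq$ is trace inclusion and $\preccurlyeq_t$ is inclusion of traces of action labels, both disregarding empty labels. $|||$ is interleaving parallel composition; $X\parallel_\chi Y$ is synchronizing composition: for $\chi$ a partial function on pairs of labels (each component may also contribute $\mathsf{skip}$, i.e. stay put), the product makes a step labeled $\chi(e,e')$ whenever it is defined. Protocol model. $\mathcal R=\mathcal R_{\mathrm{env}}\uplus\biguplus_i\mathcal R_i$, where $\mathcal R_{\mathrm{env}}$ contains the generation of fresh names $\mathsf{Fr}(x)$ and the Dolev--Yao attacker rules $[\mathsf{out}(x)]\to[\mathsf K(x)]$, $[\mathsf K(x)]\xrightarrow{[\mathsf K(x)]}[\mathsf{in}(x)]$, $[]\to[\mathsf K(x\in\mathit{pub})]$, $[\mathsf{Fr}(x)]\to[\mathsf K(x)]$, $[\mathsf K(x_1),\dots,\mathsf K(x_k)]\to[\mathsf K(f(x_1,\dots,x_k))]$ for $f\in\Sigma$ ($\mathsf K$ persistent), and $\mathcal R_i$ are the rules of role $i$, whose premises use input facts and role-$i$ state facts and whose conclusions use output facts and role-$i$ state facts, state facts carrying the run identifier. $\mathcal R_{\mathrm{role}}^i(\mathit{rid})$ is the component of role $i$, run $\mathit{rid}$: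 the rules of $\mathcal R_i$ for $\mathit{rid}$ with each input/output fact $F(\bar x)$ replaced by a private buffered copy $F_i(\mathit{rid},\bar x)$, plus rules with label $\lambda^s_{F,i,\mathit{rid}}(\bar x)$ removing a buffered output fact or adding a buffered input fact. $\mathcal R^e_{\mathrm{env}}$ is $\mathcal R_{\mathrm{env}}$ plus the matching rules with label $\lambda^e_{F,i,\mathit{rid}}(\bar x)$ adding the output fact $F(\bar x)$ or removing the input fact $F(\bar x)$. $\chi(\lambda^s_{F,i,\mathit{rid}}(\bar m),\lambda^e_{F,i,\mathit{rid}}(\bar m))=[\,]$; $\chi(e,\mathsf{skip})=e$ and $\chi(\mathsf{skip},e)=e$ for non-synchronization labels; undefined otherwise. Protocol-independent I/O. With reserved fact symbols $\mathsf{ind}$ (persistent), $\mathsf{out_{ind}},\mathsf{in_{ind}}$ (linear), $\mathcal R_{\mathrm{ind}}(\mathit{rid})$ has the rules $[\mathsf{ind}(\mathit{rid},x)]\xrightarrow{\lambda^s_{\mathsf{out_{ind}}}(\mathit{rid},x)}[]$, $[]\xrightarrow{\lambda^s_{\mathsf{in_{ind}}}(\mathit{rid},x)}[\mathsf{ind}(\mathit{rid},x)]$, $[]\to[\mathsf{ind}(\mathit{rid},x\in\mathit{pub})]$, $[]\xrightarrow{\lambda^s_{\mathsf{Fr_{ind}}}(\mathit{rid},x)}[\mathsf{ind}(\mathit{rid},x)]$, $[\mathsf{ind}(\mathit{rid},x_1),\dots,\mathsf{ind}(\mathit{rid},x_k)]\to[\mathsf{ind}(\mathit{rid},f(x_1,\dots,x_k))]$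 for $f\in\Sigma$. $\mathcal R^{e+}_{\mathrm{env}}$ is $\mathcal R^e_{\mathrm{env}}$ plus $[]\xrightarrow{\lambda^e_{\mathsf{out_{ind}}}(\mathit{rid},x)}[\mathsf{out_{ind}}(x)]$, $[\mathsf{in_{ind}}(x)]\xrightarrow{\lambda^e_{\mathsf{in_{ind}}}(\mathit{rid},x)}[]$, $[\mathsf{Fr}(x)]\xrightarrow{\lambda^e_{\mathsf{Fr_{ind}}}(\mathit{rid},x)}[]$. $\chi^+$ maps $(F^s(\mathit{rid},x),F^e(\mathit{rid},x))$ to $[\,]$ for $F\in\{\lambda_{\mathsf{out_{ind}}},\lambda_{\mathsf{in_{ind}}},\lambda_{\mathsf{Fr_{ind}}}\}$, equals $\chi$ on pairs in which neither label has such a form, and is undefined otherwise. Implementation level (framework of Arquint et al. 2022). $\mathscr C_i(\mathit{rid})$ is the LTS given by the operational semantics of $c_i(\mathit{rid})$; $\mathscr E$ is the LTS of the concrete environment. $\pi'_{\mathrm{ext}}$ relabels concrete (byte-level) I/O operations to term-level I/O operations, $\pi_{\mathrm{ext}}$ relabels those to the synchronization labels $\lambda$, $\pi_{\mathrm{int}}$ relabels internal operations to the model's action labels, $\pi=\pi_{\mathrm{int}}\circ\pi_{\mathrm{ext}}$, and $\chi'(e,e')=\chi^+(\pi_{\mathrm{ext}}(\pi'_{\mathrm{ext}}(e)),\pi_{\mathrm{ext}}(\pi'_{\mathrm{ext}}(e')))$. $\psi_i(\mathit{rid})$ is the I/O separation logic assertion generated from role $i$, identified with the set of I/O traces it permits.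 Standing properties of this framework: $\pi(\psi_i(\mathit{rid}))\preccurlyeq\mathcal R^i_{\mathrm{role}}(\mathit{rid})$; $\pi_{\mathrm{ext}}(\pi'_{\mathrm{ext}}(\mathscr E))\preccurlyeq\mathcal R^{e+}_{\mathrm{env}}$; $(|||_{i,\mathit{rid}}\mathcal R^i_{\mathrm{role}}(\mathit{rid}))\parallel_\chi\mathcal R^e_{\mathrm{env}}\preccurlyeq_t\mathcal R$; trace inclusion is compositional for $|||$ and $\parallel_\chi$. (VA) Verifier assumption: for a program $c$ with LTS $\mathscr C$, I/O specification $\phi$, relabeling $\alpha$ and taint configuration $\sigma$ (sources: secrets unknown to the attacker; sinks: protocol-independent I/O operations), if $\vdash_\alpha\{\phi\}c\{\mathsf{true}\}$ (the verifier's Hoare judgment) and the taint analysis succeeds, $\mathbb T(c,\sigma)=\mathsf{true}$, then $\alpha(\mathscr C)\preccurlyeq\phi\,|||\,\delta$, where $\delta$ is the set of traces of protocol-independent operations of the run, i.e. $\pi(\delta)$ are the traces of $\mathcal R_{\mathrm{ind}}(\mathit{rid})$. *)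

theory Defs
  imports "HOL-Library.Multiset"
begin

section \<open>Labelled transition systems\<close>

text \<open>
  A label is either an (external) I/O operation or an internal operation.  The same type serves
  all levels: at model level the I/O operations are the synchronization labels and the internal
  operations are the action labels (multisets of facts).  The empty label is \<open>Act 0\<close>; for
  multisets \<open>0\<close> is \<open>{#}\<close>, for programs \<open>0\<close> is the silent internal operation.
\<close>

datatype ('io, 'act) label = IO 'io | Act 'act

record ('s, 'l) lts =
  init :: 's
  step :: "'s \<Rightarrow> 'l \<Rightarrow> 's \<Rightarrow> bool"

inductive exec :: "('s, 'l) lts \<Rightarrow> 's \<Rightarrow> 'l list \<Rightarrow> 's \<Rightarrow> bool" for L where
  exec_Nil: "exec L s [] s"
| exec_Cons: "step L s a s' \<Longrightarrow> exec L s' w s'' \<Longrightarrow> exec L s (a # w) s''"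

definition traces :: "('s, 'l) lts \<Rightarrow> 'l list set" where
  "traces L = {w. \<exists>s. exec L (init L) w s}"

definition visible :: "('io, 'act::zero) label list \<Rightarrow> ('io, 'act) label list" where
  "visible w = filter (\<lambda>l. l \<noteq> Act 0) w"

fun actions :: "('io, 'act::zero) label list \<Rightarrow> 'act list" where
  "actions [] = []"
| "actions (IO _ # w) = actions w"
| "actions (Act a # w) = (if a = 0 then actions w else a # actions w)"

definition trace_incl ::
  "('s, ('io, 'act::zero) label) lts \<Rightarrow> ('s2, ('io, 'act) label) lts \<Rightarrow> bool"
  (infix "\<preceq>" 50) where
  "L1 \<preceq> L2 \<longleftrightarrow> visible ` traces L1 \<subseteq> visible ` traces L2"

definition action_trace_incl ::
  "('s, ('io, 'act::zero) label) lts \<Rightarrow> ('s2, ('io2, 'act) label) lts \<Rightarrow> bool"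
  (infix "\<preceq>\<^sub>t" 50) where
  "L1 \<preceq>\<^sub>t L2 \<longleftrightarrow> actions ` traces L1 \<subseteq> actions ` traces L2"

definition relabel :: "('l \<Rightarrow> 'l2) \<Rightarrow> ('s, 'l) lts \<Rightarrow> ('s, 'l2) lts" where
  "relabel f L = \<lparr>init = init L, step = (\<lambda>s b s'. \<exists>a. f a = b \<and> step L s a s')\<rparr>"

text \<open>A set of traces as an LTS; its traces are the prefixes of the given ones.\<close>

definition lts_of :: "'l list set \<Rightarrow> ('l list, 'l) lts" where
  "lts_of A = \<lparr>init = [], step = (\<lambda>u a v. v = u @ [a] \<and> (\<exists>w. v @ w \<in> A))\<rparr>"

definition interleave :: "('s, 'l) lts \<Rightarrow> ('s2, 'l) lts \<Rightarrow> ('s \<times> 's2, 'l) lts"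
  (infixr "|||" 60) where
  "L1 ||| L2 = \<lparr>init = (init L1, init L2),
     step = (\<lambda>(s, t) a (s', t'). step L1 s a s' \<and> t' = t \<or> step L2 t a t' \<and> s' = s)\<rparr>"

definition Interleave :: "'k set \<Rightarrow> ('k \<Rightarrow> ('s, 'l) lts) \<Rightarrow> ('k \<Rightarrow> 's, 'l) lts" where
  "Interleave J L = \<lparr>init = (\<lambda>k. init (L k)),
     step = (\<lambda>g a g'. \<exists>k\<in>J. \<exists>s'. step (L k) (g k) a s' \<and> g' = g(k := s'))\<rparr>"

text \<open>In a product, \<open>None\<close> as a component label stands for \<open>skip\<close>.\<close>

definition step_or_skip :: "('s, 'l) lts \<Rightarrow> 's \<Rightarrow> 'l option \<Rightarrow> 's \<Rightarrow> bool" where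
  "step_or_skip L s e s' = (case e of None \<Rightarrow> s' = s | Some a \<Rightarrow> step L s a s')"

definition sync_product ::
  "('s, 'l) lts \<Rightarrow> ('l option \<Rightarrow> 'l2 option \<Rightarrow> 'l3 option) \<Rightarrow> ('s2, 'l2) lts \<Rightarrow> ('s \<times> 's2, 'l3) lts"
  ("_ \<parallel>\<^bsub>_\<^esub> _" [56, 0, 56] 55) where
  "L1 \<parallel>\<^bsub>\<chi>\<^esub> L2 = \<lparr>init = (init L1, init L2),
     step = (\<lambda>(s, t) c (s', t'). \<exists>e e'. \<chi> e e' = Some c
        \<and> step_or_skip L1 s e s' \<and> step_or_skip L2 t e' t')\<rparr>"


section \<open>Messages, terms, facts\<close>

datatype 'f msg = Pub nat | Fresh nat | App 'f "'f msg list"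

text \<open>Ground terms over a signature, given as a set of function symbols with arities.\<close>

inductive_set msgs :: "('f \<times> nat) set \<Rightarrow> 'f msg set" for \<Sigma> where
  "Pub n \<in> msgs \<Sigma>"
| "Fresh n \<in> msgs \<Sigma>"
| "(f, length ts) \<in> \<Sigma> \<Longrightarrow> (\<And>t. t \<in> set ts \<Longrightarrow> t \<in> msgs \<Sigma>) \<Longrightarrow> App f ts \<in> msgs \<Sigma>"

datatype sort = MsgSort | PubSort | FreshSort

type_synonym var = "sort \<times> nat"

datatype 'f trm = Var var | Cst "'f msg" | Fun 'f "'f trm list"

inductive_set trms :: "('f \<times> nat) set \<Rightarrow> 'f trm set" for \<Sigma> where
  "Var x \<in> trms \<Sigma>"
| "m \<in> msgs \<Sigma> \<Longrightarrow> Cst m \<in> trms \<Sigma>"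
| "(f, length ts) \<in> \<Sigma> \<Longrightarrow> (\<And>t. t \<in> set ts \<Longrightarrow> t \<in> trms \<Sigma>) \<Longrightarrow> Fun f ts \<in> trms \<Sigma>"

primrec eval :: "(var \<Rightarrow> 'f msg) \<Rightarrow> 'f trm \<Rightarrow> 'f msg" where
  "eval \<theta> (Var x) = \<theta> x"
| "eval \<theta> (Cst m) = m"
| "eval \<theta> (Fun f ts) = App f (map (eval \<theta>) ts)"

definition ground_subst :: "('f \<times> nat) set \<Rightarrow> (var \<Rightarrow> 'f msg) \<Rightarrow> bool" where
  "ground_subst \<Sigma> \<theta> \<longleftrightarrow> (\<forall>s n. \<theta> (s, n) \<in> msgs \<Sigma>
     \<and> (s = PubSort \<longrightarrow> \<theta> (s, n) \<in> range Pub)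
     \<and> (s = FreshSort \<longrightarrow> \<theta> (s, n) \<in> range Fresh))"

text \<open>
  \<open>InF\<close>, \<open>OutF\<close> and \<open>EnvF\<close> are further input, output and environment-private symbols of a
  protocol, \<open>State i\<close> the state symbols of role \<open>i\<close>.  \<open>Buf i F\<close> is the buffered copy \<open>F\<^sub>i\<close>.
  The last three are reserved for protocol-independent I/O.
\<close>

datatype ('i, 'p) fsym =
    Fr | In | Out | K | InF 'p | OutF 'p | EnvF 'p | State 'i 'p
  | Buf 'i "('i, 'p) fsym"
  | Ind | OutInd | InInd

fun is_input :: "('i, 'p) fsym \<Rightarrow> bool" where
  "is_input Fr = True"
| "is_input In = True"
| "is_input (InF _) = True"
| "is_input _ = False"

fun is_output :: "('i, 'p) fsym \<Rightarrow> bool" where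
  "is_output Out = True"
| "is_output (OutF _) = True"
| "is_output _ = False"

definition is_env :: "('i, 'p) fsym \<Rightarrow> bool" where
  "is_env F \<longleftrightarrow> is_input F \<or> is_output F \<or> F = K \<or> F \<in> range EnvF"

fun persistent :: "('p \<Rightarrow> bool) \<Rightarrow> ('i, 'p) fsym \<Rightarrow> bool" where
  "persistent P K = True"
| "persistent P Ind = True"
| "persistent P (InF p) = P p"
| "persistent P (OutF p) = P p"
| "persistent P (EnvF p) = P p"
| "persistent P (State i p) = P p"
| "persistent P (Buf i F) = persistent P F"
| "persistent P _ = False"

datatype (dead 'i, dead 'p, 't) fact = Fact (sym: "('i, 'p) fsym") (args: "'t list")


section \<open>Synchronization labels and multiset rewriting\<close>

text \<open>
  \<open>Lam Sys F i rid xs\<close> and \<open>Lam Env F i rid xs\<close> are the labels \<open>\<lambda>\<^sup>s\<close> and \<open>\<lambda>\<^sup>e\<close> with index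
  \<open>F, i, rid\<close>; \<open>LamInd\<close> gives the corresponding labels for protocol-independent operations.
\<close>

datatype side = Sys | Env

datatype ind_op = OutOp | InOp | FrOp

datatype (dead 'i, dead 'p, 't) sync =
    Lam side "('i, 'p) fsym" 'i 't "'t list"
  | LamInd side ind_op 't 't

type_synonym ('i, 'p, 't) mlabel = "(('i, 'p, 't) sync, ('i, 'p, 't) fact multiset) label"

datatype (dead 'i, dead 'p, 't) rule =
  Rule (lhs: "('i, 'p, 't) fact multiset") (lab: "('i, 'p, 't) mlabel")
    (rhs: "('i, 'p, 't) fact multiset")

definition ginsts ::
  "('f \<times> nat) set \<Rightarrow> ('i, 'p, 'f trm) rule set \<Rightarrow> ('i, 'p, 'f msg) rule set" where
  "ginsts \<Sigma> R = {map_rule (eval \<theta>) \<rho> | \<rho> \<theta>. \<rho> \<in> R \<and> ground_subst \<Sigma> \<theta>}"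

text \<open>
  The state is the multiset of facts, together with the names already generated by \<open>Fr\<close>: this
  second component only expresses that a generated name is fresh, i.e. generated at most once.
\<close>

definition msr_step ::
  "('f \<times> nat) set \<Rightarrow> ('p \<Rightarrow> bool) \<Rightarrow> ('i, 'p, 'f trm) rule set \<Rightarrow>
   ('i, 'p, 'f msg) fact multiset \<times> 'f msg set \<Rightarrow> ('i, 'p, 'f msg) mlabel \<Rightarrow>
   ('i, 'p, 'f msg) fact multiset \<times> 'f msg set \<Rightarrow> bool" where
  "msr_step \<Sigma> P R = (\<lambda>(S, N) a (S', N').
     \<exists>\<rho> \<in> ginsts \<Sigma> R.
       let linear = filter_mset (\<lambda>f. \<not> persistent P (sym f)) (lhs \<rho>);
           generated = {m. Fact Fr [m] \<in># rhs \<rho>}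
       in linear \<subseteq># S \<and> set_mset (lhs \<rho>) \<subseteq> set_mset S \<and> generated \<inter> N = {}
          \<and> a = lab \<rho> \<and> S' = S - linear + rhs \<rho> \<and> N' = N \<union> generated)"

definition msr ::
  "('f \<times> nat) set \<Rightarrow> ('p \<Rightarrow> bool) \<Rightarrow> ('i, 'p, 'f trm) rule set \<Rightarrow>
   (('i, 'p, 'f msg) fact multiset \<times> 'f msg set, ('i, 'p, 'f msg) mlabel) lts" where
  "msr \<Sigma> P R = \<lparr>init = ({#}, {}), step = msr_step \<Sigma> P R\<rparr>"


section \<open>Protocol models\<close>

abbreviation var0 :: "'f trm" where "var0 \<equiv> Var (MsgSort, 0)"

abbreviation vars :: "nat \<Rightarrow> 'f trm list" where "vars n \<equiv> map (\<lambda>k. Var (MsgSort, k)) [0..<n]"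

abbreviation silent :: "('i, 'p, 't) mlabel" where "silent \<equiv> Act {#}"

definition fresh_rule :: "('i, 'p, 'f trm) rule" where
  "fresh_rule = Rule {#} silent {#Fact Fr [Var (FreshSort, 0)]#}"

definition attacker_rules :: "('f \<times> nat) set \<Rightarrow> ('i, 'p, 'f trm) rule set" where
  "attacker_rules \<Sigma> =
     {Rule {#Fact Out [var0]#} silent {#Fact K [var0]#},
      Rule {#Fact K [var0]#} (Act {#Fact K [var0]#}) {#Fact In [var0]#},
      Rule {#} silent {#Fact K [Var (PubSort, 0)]#},
      Rule {#Fact Fr [var0]#} silent {#Fact K [var0]#}}
   \<union> {Rule (mset (map (\<lambda>x. Fact K [x]) (vars k))) silent {#Fact K [Fun f (vars k)]#}
       | f k. (f, k) \<in> \<Sigma>}"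

text \<open>\<open>runs\<close> is the set of run identifiers; \<open>pers\<close> tells which protocol symbols are persistent.\<close>

record ('i, 'p, 'f) model =
  sig :: "('f \<times> nat) set"
  pers :: "'p \<Rightarrow> bool"
  runs :: "'f msg set"
  env_rules :: "('i, 'p, 'f trm) rule set"
  role_rules :: "'i \<Rightarrow> ('i, 'p, 'f trm) rule set"

text \<open>
  In role rules the variable \<open>rid_var\<close> is reserved for the run identifier, which is the first
  argument of each state fact.
\<close>

definition rid_var :: var where "rid_var = (MsgSort, 0)"

definition role_state_fact :: "'i \<Rightarrow> ('i, 'p, 'f trm) fact \<Rightarrow> bool" where
  "role_state_fact i f \<longleftrightarrow> (\<exists>p ts. f = Fact (State i p) (Var rid_var # ts))"

definition protocol_model :: "('i, 'p, 'f) model \<Rightarrow> bool" where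
  "protocol_model M \<longleftrightarrow>
     runs M \<subseteq> msgs (sig M)
   \<and> insert fresh_rule (attacker_rules (sig M)) \<subseteq> env_rules M
   \<and> (\<forall>\<rho> \<in> env_rules M \<union> (\<Union>i. role_rules M i). set_rule \<rho> \<subseteq> trms (sig M) \<and> lab \<rho> \<in> range Act)
   \<and> (\<forall>\<rho> \<in> env_rules M. \<forall>f \<in># lhs \<rho> + rhs \<rho>. is_env (sym f))
   \<and> (\<forall>i. \<forall>\<rho> \<in> role_rules M i.
        (\<forall>f \<in># lhs \<rho>. is_input (sym f) \<or> role_state_fact i f)
      \<and> (\<forall>f \<in># rhs \<rho>. is_output (sym f) \<or> role_state_fact i f))
   \<and> (\<forall>i. env_rules M \<inter> role_rules M i = {})
   \<and> (\<forall>i j. i \<noteq> j \<longrightarrow> role_rules M i \<inter> role_rules M j = {})"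

definition msr_of ::
  "('i, 'p, 'f) model \<Rightarrow> ('i, 'p, 'f trm) rule set \<Rightarrow>
   (('i, 'p, 'f msg) fact multiset \<times> 'f msg set, ('i, 'p, 'f msg) mlabel) lts" where
  "msr_of M R = msr (sig M) (pers M) R"

definition protocol_rules :: "('i, 'p, 'f) model \<Rightarrow> ('i, 'p, 'f trm) rule set" where
  "protocol_rules M = env_rules M \<union> (\<Union>i. role_rules M i)"


section \<open>Decomposition into role components and environment\<close>

primrec set_rid :: "'f msg \<Rightarrow> 'f trm \<Rightarrow> 'f trm" where
  "set_rid rid (Var x) = (if x = rid_var then Cst rid else Var x)"
| "set_rid rid (Cst m) = Cst m"
| "set_rid rid (Fun f ts) = Fun f (map (set_rid rid) ts)"

fun buffer :: "'i \<Rightarrow> 'f msg \<Rightarrow> ('i, 'p, 'f trm) fact \<Rightarrow> ('i, 'p, 'f trm) fact" where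
  "buffer i rid (Fact F ts) =
     (if is_input F \<or> is_output F then Fact (Buf i F) (Cst rid # ts) else Fact F ts)"

fun buffer_rule :: "'i \<Rightarrow> 'f msg \<Rightarrow> ('i, 'p, 'f trm) rule \<Rightarrow> ('i, 'p, 'f trm) rule" where
  "buffer_rule i rid (Rule l a r) =
     Rule (image_mset (buffer i rid) l) a (image_mset (buffer i rid) r)"

definition role_run_rules ::
  "('i, 'p, 'f) model \<Rightarrow> 'i \<Rightarrow> 'f msg \<Rightarrow> ('i, 'p, 'f trm) rule set" where
  "role_run_rules M i rid =
     (\<lambda>\<rho>. buffer_rule i rid (map_rule (set_rid rid) \<rho>)) ` role_rules M i
   \<union> {Rule {#Fact (Buf i F) (Cst rid # vars n)#} (IO (Lam Sys F i (Cst rid) (vars n))) {#}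
       | F n. is_output F}
   \<union> {Rule {#} (IO (Lam Sys F i (Cst rid) (vars n))) {#Fact (Buf i F) (Cst rid # vars n)#}
       | F n. is_input F}"

definition env_sync_rules :: "('i, 'p, 'f) model \<Rightarrow> ('i, 'p, 'f trm) rule set" where
  "env_sync_rules M = env_rules M
   \<union> {Rule {#} (IO (Lam Env F i (Cst rid) (vars n))) {#Fact F (vars n)#}
       | F i rid n. is_output F \<and> rid \<in> runs M}
   \<union> {Rule {#Fact F (vars n)#} (IO (Lam Env F i (Cst rid) (vars n))) {#}
       | F i rid n. is_input F \<and> rid \<in> runs M}"

definition ind_rules :: "('i, 'p, 'f) model \<Rightarrow> 'f msg \<Rightarrow> ('i, 'p, 'f trm) rule set" where
  "ind_rules M rid =
     {Rule {#Fact Ind [Cst rid, var0]#} (IO (LamInd Sys OutOp (Cst rid) var0)) {#},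
      Rule {#} (IO (LamInd Sys InOp (Cst rid) var0)) {#Fact Ind [Cst rid, var0]#},
      Rule {#} silent {#Fact Ind [Cst rid, Var (PubSort, 0)]#},
      Rule {#} (IO (LamInd Sys FrOp (Cst rid) var0)) {#Fact Ind [Cst rid, var0]#}}
   \<union> {Rule (mset (map (\<lambda>x. Fact Ind [Cst rid, x]) (vars k))) silent
         {#Fact Ind [Cst rid, Fun f (vars k)]#}
       | f k. (f, k) \<in> sig M}"

definition env_ind_rules :: "('i, 'p, 'f) model \<Rightarrow> ('i, 'p, 'f trm) rule set" where
  "env_ind_rules M = env_sync_rules M
   \<union> (\<Union>rid \<in> runs M.
       {Rule {#} (IO (LamInd Env OutOp (Cst rid) var0)) {#Fact OutInd [var0]#},
        Rule {#Fact InInd [var0]#} (IO (LamInd Env InOp (Cst rid) var0)) {#},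
        Rule {#Fact Fr [var0]#} (IO (LamInd Env FrOp (Cst rid) var0)) {#}})"

fun chi ::
  "('i, 'p, 't) mlabel option \<Rightarrow> ('i, 'p, 't) mlabel option \<Rightarrow> ('i, 'p, 't) mlabel option" where
  "chi (Some (IO (Lam Sys F i rid xs))) (Some (IO (Lam Env F' i' rid' xs'))) =
     (if F = F' \<and> i = i' \<and> rid = rid' \<and> xs = xs' then Some silent else None)"
| "chi (Some (Act a)) None = Some (Act a)"
| "chi None (Some (Act a)) = Some (Act a)"
| "chi _ _ = None"

fun is_ind_label :: "('i, 'p, 't) mlabel option \<Rightarrow> bool" where
  "is_ind_label (Some (IO (LamInd _ _ _ _))) = True"
| "is_ind_label _ = False"

definition chi_plus ::
  "('i, 'p, 't) mlabel option \<Rightarrow> ('i, 'p, 't) mlabel option \<Rightarrow> ('i, 'p, 't) mlabel option" where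
  "chi_plus e e' =
     (if \<exists>d rid x. e = Some (IO (LamInd Sys d rid x)) \<and> e' = Some (IO (LamInd Env d rid x))
      then Some silent
      else if \<not> is_ind_label e \<and> \<not> is_ind_label e' then chi e e'
      else None)"


section \<open>Implementations\<close>

abbreviation pi_ext :: "('io \<Rightarrow> 'io2) \<Rightarrow> ('io, 'act) label \<Rightarrow> ('io2, 'act) label" where
  "pi_ext g \<equiv> map_label g id"

abbreviation pi_int :: "('act \<Rightarrow> 'act2) \<Rightarrow> ('io, 'act) label \<Rightarrow> ('io, 'act2) label" where
  "pi_int h \<equiv> map_label id h"

definition chi_impl ::
  "('b \<Rightarrow> 'o) \<Rightarrow> ('o \<Rightarrow> ('i, 'p, 't) sync) \<Rightarrow>
   ('b, ('i, 'p, 't) fact multiset) label option \<Rightarrow>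
   ('b, ('i, 'p, 't) fact multiset) label option \<Rightarrow> ('i, 'p, 't) mlabel option" where
  "chi_impl ext' ext e e' =
     chi_plus (map_option (pi_ext ext \<circ> pi_ext ext') e) (map_option (pi_ext ext \<circ> pi_ext ext') e')"

definition ind_ops :: "('b \<Rightarrow> 'o) \<Rightarrow> ('o \<Rightarrow> ('i, 'p, 't) sync) \<Rightarrow> 'b set" where
  "ind_ops ext' ext = {b. \<exists>s d rid x. ext (ext' b) = LamInd s d rid x}"

record ('src, 'b) taint_config =
  sources :: "'src set"
  sinks :: "'b set"

text \<open>
  \<open>hoare \<alpha> \<phi> c \<phi>'\<close> is the verifier's judgment, \<open>true\<close> the trivial assertion, \<open>permits \<phi>\<close> the set
  of I/O traces an assertion permits, \<open>sem c\<close> the operational semantics, \<open>taint\<close> the taint analysis,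
  \<open>secrets c\<close> the secrets of \<open>c\<close> unknown to the attacker, \<open>ops\<close> the protocol-independent I/O
  operations, \<open>run_of c\<close> the run identifier \<open>c\<close> is executed with, and \<open>\<delta> rid\<close> the set of traces
  of protocol-independent operations of run \<open>rid\<close>.
\<close>

definition verifier_assumption ::
  "((('b, 'n) label \<Rightarrow> ('o, 'n) label) \<Rightarrow> 'asn \<Rightarrow> 'prog \<Rightarrow> 'asn \<Rightarrow> bool) \<Rightarrow> 'asn \<Rightarrow>
   ('asn \<Rightarrow> ('o, 'n::zero) label list set) \<Rightarrow> ('prog \<Rightarrow> ('s, ('b, 'n) label) lts) \<Rightarrow>
   ('prog \<Rightarrow> ('src, 'b) taint_config \<Rightarrow> bool) \<Rightarrow> ('prog \<Rightarrow> 'src set) \<Rightarrow> 'b set \<Rightarrow>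
   ('prog \<Rightarrow> 'rid) \<Rightarrow> ('rid \<Rightarrow> ('o, 'n) label list set) \<Rightarrow> bool" where
  "verifier_assumption hoare true permits sem taint secrets ops run_of \<delta> \<longleftrightarrow>
     (\<forall>c \<phi> \<alpha> \<sigma>. sources \<sigma> = secrets c \<longrightarrow> sinks \<sigma> = ops \<longrightarrow>
        hoare \<alpha> \<phi> c true \<longrightarrow> taint c \<sigma> \<longrightarrow>
        relabel \<alpha> (sem c) \<preceq> (lts_of (permits \<phi>) ||| lts_of (\<delta> (run_of c))))"

end

theory Submission
  imports Defs
begin

text \<open>
  Trace inclusion is compositional, because silent steps of a component can always be inserted into
  a run of the product.  By the verifier assumption each program may therefore be replaced by its
  role component interleaved with \<open>ind_rules\<close>, and the concrete environment by its model.  The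
  resulting system is simulated by the undecomposed protocol: undoing the buffering turns the facts
  of all role components and of the environment, taken together, into a part of the protocol state,
  so that synchronizations leave that state unchanged.  Protocol-independent operations need no
  counterpart at all, since they can only remove facts that environment rules use.
\<close>

section \<open>Executions\<close>

text \<open>Two features of the model rule out a simulation by equality of states. Rules do not
  consume persistent facts, so a synchronization on a persistent symbol copies the fact instead of
  moving it, and the decomposed system ends up with more copies than the protocol. Moreover the
  environment may lose \<open>Fr\<close> facts that the protocol retains. States are therefore
  compared by \<open>covers\<close>, an inclusion that counts linear facts but only asks for the
  presence of persistent ones. This is at the same time the applicability condition of a rule, so
  enabledness transfers to the protocol by transitivity. The sets of generated names, in contrast,
  are kept equal: a name that is fresh for the environment has to be fresh for the protocol as well.
  The concrete product relabels inside its synchronization function, on components to which the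
  internal relabeling has already been applied. This is why the composition lemma for products
  carries relabelings in its synchronization function, and why the internal and external relabelings
  have to be commuted at the end.\<close>

declare exec_Nil [simp]

lemma init_simps [simp]:
  "init (relabel f L1) = init L1"
  "init (L1 ||| L2) = (init L1, init L2)"
  "init (Interleave J L) = (\<lambda>k. init (L k))"
  "init (Interleave J L \<parallel>\<^bsub>\<chi>\<^esub> L2) = (\<lambda>k. init (L k), init L2)"
  by (simp_all add: relabel_def interleave_def Interleave_def sync_product_def)

lemma step_relabel [simp]: "step (relabel f L) s b s' \<longleftrightarrow> (\<exists>a. f a = b \<and> step L s a s')"
  by (simp add: relabel_def)

lemma step_interleave [simp]:
  "step (L1 ||| L2) st a st' \<longleftrightarrow>
     step L1 (fst st) a (fst st') \<and> snd st' = snd st \<or>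
     step L2 (snd st) a (snd st') \<and> fst st' = fst st"
  by (simp add: interleave_def split_beta)

lemma step_Interleave [simp]:
  "step (Interleave J L) g a g' \<longleftrightarrow> (\<exists>k\<in>J. \<exists>s'. step (L k) (g k) a s' \<and> g' = g(k := s'))"
  by (simp add: Interleave_def)

lemma step_sync_product:
  "step (L1 \<parallel>\<^bsub>\<chi>\<^esub> L2) st c st' \<longleftrightarrow>
     (\<exists>e e'. \<chi> e e' = Some c \<and> step_or_skip L1 (fst st) e (fst st')
        \<and> step_or_skip L2 (snd st) e' (snd st'))"
  by (simp add: sync_product_def split_beta)

lemma step_or_skip_simps [simp]:
  "step_or_skip L s None s' \<longleftrightarrow> s' = s"
  "step_or_skip L s (Some a) s' \<longleftrightarrow> step L s a s'"
  by (simp_all add: step_or_skip_def)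

lemma exec_append: "exec L s u s' \<Longrightarrow> exec L s' v s'' \<Longrightarrow> exec L s (u @ v) s''"
  by (induction rule: exec.induct) (auto intro: exec.intros)

lemma exec_appendD: "exec L s (u @ v) s'' \<Longrightarrow> \<exists>s'. exec L s u s' \<and> exec L s' v s''"
proof (induction u arbitrary: s)
  case Nil
  then show ?case by (auto intro: exec.intros)
next
  case (Cons a u)
  from Cons.prems obtain t where "step L s a t" "exec L t (u @ v) s''"
    by (auto elim: exec.cases)
  with Cons.IH show ?case by (meson exec_Cons)
qed

lemma Nil_in_traces [simp]: "[] \<in> traces L"
  by (auto simp: traces_def intro: exec.intros)

lemma traces_appendD: "u @ v \<in> traces L \<Longrightarrow> u \<in> traces L"
  by (auto simp: traces_def dest: exec_appendD)

lemma exec_map_relabel: "exec L s w s' \<Longrightarrow> exec (relabel f L) s (map f w) s'"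
  by (induction rule: exec.induct) (auto intro!: exec_Cons)

lemma exec_relabelD: "exec (relabel f L) s w s' \<Longrightarrow> \<exists>v. w = map f v \<and> exec L s v s'"
proof (induction w arbitrary: s)
  case Nil
  then show ?case by (auto elim: exec.cases intro: exec.intros)
next
  case (Cons b w)
  from Cons.prems obtain t a where "f a = b" "step L s a t" "exec (relabel f L) t w s'"
    by (auto elim!: exec.cases[of _ _ "_ # _"] simp: relabel_def)
  with Cons.IH[of t] show ?case by (metis exec_Cons list.simps(9))
qed

lemma traces_relabel: "traces (relabel f L) = map f ` traces L"
  by (force simp: traces_def dest: exec_map_relabel exec_relabelD)

lemma relabel_relabel: "relabel f (relabel g L) = relabel (f \<circ> g) L"
  by (auto simp: relabel_def fun_eq_iff)

lemma relabel_interleave: "relabel f (L1 ||| L2) = (relabel f L1 ||| relabel f L2)"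
  by (auto simp: relabel_def interleave_def fun_eq_iff)

lemma visible_append [simp]: "visible (u @ v) = visible u @ visible v"
  by (simp add: visible_def)

lemma actions_append [simp]: "actions (u @ v) = actions u @ actions v"
  by (induction u rule: actions.induct) auto

lemma actions_silent: "visible w = [] \<Longrightarrow> actions w = []"
  by (induction w rule: actions.induct) (auto simp: visible_def split: if_splits)

lemma visible_eq_ConsD:
  assumes "visible w = a # v"
  obtains u w' where "w = u @ a # w'" "visible u = []" "visible w' = v"
  using assms unfolding visible_def filter_eq_Cons_iff by auto

text \<open>Lets prefix closure of traces pass to their visible parts: a cut in the visible word
  lifts to a cut in the trace itself.\<close>

lemma visible_eq_appendD:
  assumes "visible w = u @ v"
  obtains w1 w2 where "w = w1 @ w2" "visible w1 = u" "visible w2 = v"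
  using assms
proof (induction u arbitrary: w thesis)
  case Nil
  show ?case
    by (rule Nil.prems(1)[of "[]" w]) (use Nil.prems(2) in \<open>auto simp: visible_def\<close>)
next
  case (Cons a u)
  from Cons.prems(2) obtain w1 w2 where "w = w1 @ a # w2" "visible w1 = []" "visible w2 = u @ v"
    by (auto elim: visible_eq_ConsD)
  moreover from Cons.IH[OF _ this(3)] obtain w3 w4 where
    "w2 = w3 @ w4" "visible w3 = u" "visible w4 = v" by blast
  moreover have "a \<noteq> Act 0"
    using Cons.prems(2) by (auto simp: visible_def filter_eq_Cons_iff)
  ultimately show ?case
    by (intro Cons.prems(1)[of "w1 @ a # w3" w4]) (auto simp: visible_def)
qed


section \<open>Compositionality of trace inclusion\<close>

lemma trace_incl_trans: "L1 \<preceq> L2 \<Longrightarrow> L2 \<preceq> L3 \<Longrightarrow> L1 \<preceq> L3"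
  by (auto simp: trace_incl_def)

text \<open>A relabeling that fixes the silent label may hide further labels but never reveals one,
  so what was invisible before stays irrelevant afterwards.\<close>

lemma visible_map_visible:
  assumes "f (Act 0) = Act 0"
  shows "visible (map f (visible w)) = visible (map f w)"
  using assms by (induction w) (auto simp: visible_def)

lemma trace_incl_relabel:
  assumes "f (Act 0) = Act 0" "L1 \<preceq> L2"
  shows "relabel f L1 \<preceq> relabel f L2"
  unfolding trace_incl_def traces_relabel
proof clarsimp
  fix w assume "w \<in> traces L1"
  then obtain v where "v \<in> traces L2" "visible v = visible w"
    using assms(2) by (auto simp: trace_incl_def image_subset_iff)
  then show "visible (map f w) \<in> visible ` map f ` traces L2"
    by (metis assms(1) visible_map_visible imageI)
qed

section \<open>Interleaving: traces as shuffles of component traces\<close>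

lemma exec_interleave_shuffles:
  "exec (L1 ||| L2) st w st' \<Longrightarrow>
    \<exists>u v. w \<in> shuffles u v \<and> exec L1 (fst st) u (fst st') \<and> exec L2 (snd st) v (snd st')"
proof (induction rule: exec.induct)
  case (exec_Nil s)
  then show ?case by (auto intro!: exI[of _ "[]"] exec.intros)
next
  case (exec_Cons s a s' w s'')
  then obtain u v where uv: "w \<in> shuffles u v" "exec L1 (fst s') u (fst s'')"
    "exec L2 (snd s') v (snd s'')"
    by auto
  from exec_Cons.hyps(1) consider
      "step L1 (fst s) a (fst s')" "snd s' = snd s"
    | "step L2 (snd s) a (snd s')" "fst s' = fst s"
    by auto
  then show ?case
  proof cases
    case 1
    with uv have "exec L1 (fst s) (a # u) (fst s'')" "exec L2 (snd s) v (snd s'')"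
      by (auto intro: exec.intros)
    with uv(1) show ?thesis by (blast intro: Cons_in_shuffles_leftI)
  next
    case 2
    with uv have "exec L1 (fst s) u (fst s'')" "exec L2 (snd s) (a # v) (snd s'')"
      by (auto intro: exec.intros)
    with uv(1) show ?thesis by (blast intro: Cons_in_shuffles_rightI)
  qed
qed

lemma exec_shuffles_interleave:
  "w \<in> shuffles u v \<Longrightarrow> exec L1 s u s' \<Longrightarrow> exec L2 t v t' \<Longrightarrow>
    exec (L1 ||| L2) (s, t) w (s', t')"
proof (induction w arbitrary: u v s t)
  case Nil
  then show ?case by (auto elim: exec.cases intro: exec.intros)
next
  case (Cons a w)
  from Cons.prems(1) consider
      u' where "u = a # u'" "w \<in> shuffles u' v"
    | v' where "v = a # v'" "w \<in> shuffles u v'"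
    by (auto simp: Cons_in_shuffles_iff neq_Nil_conv)
  then show ?case
  proof cases
    case 1
    with Cons.prems obtain s1 where "step L1 s a s1" "exec L1 s1 u' s'"
      by (auto elim: exec.cases)
    with 1 Cons show ?thesis
      by (intro exec_Cons[of _ _ _ "(s1, t)"]) auto
  next
    case 2
    with Cons.prems obtain t1 where "step L2 t a t1" "exec L2 t1 v' t'"
      by (auto elim: exec.cases)
    with 2 Cons show ?thesis
      by (intro exec_Cons[of _ _ _ "(s, t1)"]) auto
  qed
qed

lemma traces_interleave:
  "traces (L1 ||| L2) = (\<Union>u \<in> traces L1. \<Union>v \<in> traces L2. shuffles u v)"
  by (fastforce simp: traces_def dest!: exec_interleave_shuffles
      intro: exec_shuffles_interleave)

lemma visible_shuffles: "visible ` shuffles u v = shuffles (visible u) (visible v)"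
  unfolding visible_def by (rule filter_shuffles)

text \<open>Erasing silent labels commutes with shuffling, so the visible interleavings depend only
  on the visible traces of the two sides; no schedule for the silent steps has to be built.\<close>

lemma trace_incl_interleave:
  assumes "L1 \<preceq> L1'" "L2 \<preceq> L2'"
  shows "(L1 ||| L2) \<preceq> (L1' ||| L2')"
  unfolding trace_incl_def
proof clarify
  fix w assume "w \<in> traces (L1 ||| L2)"
  then obtain u v where uv: "u \<in> traces L1" "v \<in> traces L2" "w \<in> shuffles u v"
    by (auto simp: traces_interleave)
  obtain u' where u': "u' \<in> traces L1'" "visible u' = visible u"
    using assms(1) uv(1) by (auto simp: trace_incl_def image_subset_iff)
  obtain v' where v': "v' \<in> traces L2'" "visible v' = visible v"
    using assms(2) uv(2) by (auto simp: trace_incl_def image_subset_iff)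
  have "visible w \<in> visible ` shuffles u' v'"
    unfolding visible_shuffles u'(2) v'(2)
    unfolding visible_shuffles[symmetric] using uv(3) by (rule imageI)
  then show "visible w \<in> visible ` traces (L1' ||| L2')"
    using u'(1) v'(1) by (auto simp: traces_interleave)
qed

section \<open>Trace sets viewed as transition systems\<close>

lemma exec_lts_of: "exec (lts_of A) u w v \<Longrightarrow> v = u @ w \<and> (w = [] \<or> (\<exists>z. v @ z \<in> A))"
proof (induction rule: exec.induct)
  case (exec_Cons s a s' w s'')
  then show ?case by (cases w) (auto simp: lts_of_def elim: exec.cases)
qed simp

text \<open>\<open>lts_of\<close> adds all prefixes of words in \<open>A\<close>. They do no harm,
  since the visible traces of any transition system are closed under prefixes.\<close>

lemma trace_incl_lts_of:
  assumes "f (Act 0) = Act 0" "visible ` map f ` A \<subseteq> visible ` traces L"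
  shows "relabel f (lts_of A) \<preceq> L"
  unfolding trace_incl_def traces_relabel
proof clarsimp
  fix w assume "w \<in> traces (lts_of A)"
  \<comment> \<open>The empty word is a trace of \<open>lts_of A\<close> even for empty
    \<open>A\<close>, hence the separate case.\<close>
  then consider "w = []" | z where "w @ z \<in> A"
    by (auto simp: traces_def lts_of_def dest!: exec_lts_of[unfolded lts_of_def])
  then show "visible (map f w) \<in> visible ` traces L"
  proof cases
    case 1
    then show ?thesis by (auto intro: rev_image_eqI[of "[]"])
  next
    case 2
    then have "visible (map f (w @ z)) \<in> visible ` traces L"
      using assms(2) by blast
    then obtain t where "t \<in> traces L" "visible t = visible (map f w) @ visible (map f z)"
      by auto
    then show ?thesis
      by (metis visible_eq_appendD traces_appendD imageI)
  qed
qed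

section \<open>Runs of the synchronizing product as lists of events\<close>

type_synonym ('k, 'l, 'm) event = "('k \<times> 'l) option \<times> 'm option"

primrec comp_trace :: "'k \<Rightarrow> ('k, 'l, 'm) event list \<Rightarrow> 'l list" where
  "comp_trace k [] = []"
| "comp_trace k (x # xs) =
     (case fst x of Some (j, a) \<Rightarrow> if j = k then [a] else [] | None \<Rightarrow> []) @ comp_trace k xs"

primrec env_trace :: "('k, 'l, 'm) event list \<Rightarrow> 'm list" where
  "env_trace [] = []"
| "env_trace (x # xs) = (case snd x of Some b \<Rightarrow> [b] | None \<Rightarrow> []) @ env_trace xs"

text \<open>An event list is a schedule without states: it records which component and whether the
  environment moves, and with which labels. A run of one product can thus be projected to its parts
  and rebuilt in another product with different state spaces.\<close>

definition produces ::
  "('l option \<Rightarrow> 'm option \<Rightarrow> 'n option) \<Rightarrow> 'k set \<Rightarrow> ('k, 'l, 'm) event list \<Rightarrow> 'n list \<Rightarrow> bool" where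
  "produces \<chi> J = list_all2 (\<lambda>x a.
     \<chi> (map_option snd (fst x)) (snd x) = Some a \<and> fst ` set_option (fst x) \<subseteq> J)"

lemma exec_sync_productD:
  "exec (Interleave J L \<parallel>\<^bsub>\<chi>\<^esub> E) st w st' \<Longrightarrow>
    \<exists>xs. produces \<chi> J xs w \<and> (\<forall>k. exec (L k) (fst st k) (comp_trace k xs) (fst st' k))
      \<and> exec E (snd st) (env_trace xs) (snd st')"
proof (induction rule: exec.induct)
  case (exec_Nil s)
  then show ?case by (auto intro!: exI[of _ "[]"] exec.intros simp: produces_def)
next
  case (exec_Cons s a s' w s'')
  then obtain xs where xs: "produces \<chi> J xs w"
    "\<And>k. exec (L k) (fst s' k) (comp_trace k xs) (fst s'' k)"
    "exec E (snd s') (env_trace xs) (snd s'')"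
    by auto
  from exec_Cons.hyps(1) obtain e e' where e: "\<chi> e e' = Some a"
    "step_or_skip (Interleave J L) (fst s) e (fst s')" "step_or_skip E (snd s) e' (snd s')"
    by (auto simp: step_sync_product)
  have "exec E (snd s) ((case e' of Some b \<Rightarrow> [b] | None \<Rightarrow> []) @ env_trace xs) (snd s'')"
    using e(3) xs(3) by (auto split: option.splits intro: exec.intros)
  moreover have "\<exists>x. map_option snd x = e \<and> fst ` set_option x \<subseteq> J \<and>
     (\<forall>k. exec (L k) (fst s k)
        ((case x of Some (j, a) \<Rightarrow> if j = k then [a] else [] | None \<Rightarrow> []) @ comp_trace k xs)
        (fst s'' k))"
  proof (cases e)
    case None
    with e(2) xs(2) show ?thesis by auto
  next
    case (Some b)
    with e(2) obtain k t where k: "k \<in> J" "step (L k) (fst s k) b t" "fst s' = (fst s)(k := t)"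
      by auto
    have "exec (L j) (fst s j) ((if k = j then [b] else []) @ comp_trace j xs) (fst s'' j)" for j
      using xs(2)[of j] k by (auto split: if_splits intro: exec.intros)
    with Some k(1) show ?thesis by (intro exI[of _ "Some (k, b)"]) auto
  qed
  then obtain x where "map_option snd x = e" "fst ` set_option x \<subseteq> J"
     "\<And>k. exec (L k) (fst s k)
        ((case x of Some (j, a) \<Rightarrow> if j = k then [a] else [] | None \<Rightarrow> []) @ comp_trace k xs)
        (fst s'' k)"
    by blast
  ultimately show ?case
    using xs(1) e(1) by (intro exI[of _ "(x, e') # xs"]) (simp add: produces_def)
qed

text \<open>Serves two purposes: silent steps of a new component may be inserted anywhere, and
  silent events of the given schedule may be dropped, because a silent label never synchronizes and
  yields only a silent label.\<close>

definition respects_silent ::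
  "(('io, 'a::zero) label option \<Rightarrow> ('io2, 'b::zero) label option \<Rightarrow> ('io3, 'c::zero) label option)
    \<Rightarrow> bool" where
  "respects_silent \<chi> \<longleftrightarrow>
     (\<forall>e'. \<chi> (Some (Act 0)) e' = (if e' = None then Some (Act 0) else None))
   \<and> (\<forall>e. \<chi> e (Some (Act 0)) = (if e = None then Some (Act 0) else None))"

lemma silent_left:
  "respects_silent \<chi> \<Longrightarrow> \<chi> (Some (Act 0)) e' = Some c \<Longrightarrow> e' = None \<and> c = Act 0"
  by (auto simp: respects_silent_def split: if_splits)

lemma silent_right:
  "respects_silent \<chi> \<Longrightarrow> \<chi> e (Some (Act 0)) = Some c \<Longrightarrow> e = None \<and> c = Act 0"
  by (auto simp: respects_silent_def split: if_splits)

lemma exec_silent_left: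
  fixes L :: "'k \<Rightarrow> ('s, ('io, 'a::zero) label) lts"
    and \<chi> :: "('io, 'a) label option \<Rightarrow> ('io2, 'b::zero) label option \<Rightarrow> ('io3, 'c::zero) label option"
  assumes "exec (L k) s w s'" "visible w = []" "respects_silent \<chi>" "k \<in> J"
  shows "\<exists>v. visible v = [] \<and> exec (Interleave J L \<parallel>\<^bsub>\<chi>\<^esub> E) (g(k := s), e) v (g(k := s'), e)"
  using assms
proof (induction rule: exec.induct)
  case (exec_Nil s)
  then show ?case by (auto intro!: exI[of _ "[]"] simp: visible_def)
next
  case (exec_Cons s a s' w s'')
  then have a: "a = Act 0" and w: "visible w = []"
    by (auto simp: visible_def split: if_splits)
  have "step (Interleave J L \<parallel>\<^bsub>\<chi>\<^esub> E) (g(k := s), e) (Act 0) (g(k := s'), e)"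
    unfolding step_sync_product
    using exec_Cons.hyps exec_Cons.prems a
    by (intro exI[of _ "Some (Act 0)"] exI[of _ None])
       (auto simp: respects_silent_def intro!: bexI[of _ k] exI[of _ s'])
  moreover obtain v where "visible v = []"
    and "exec (Interleave J L \<parallel>\<^bsub>\<chi>\<^esub> E) (g(k := s'), e) v (g(k := s''), e)"
    using exec_Cons.IH exec_Cons.prems w by blast
  ultimately have "exec (Interleave J L \<parallel>\<^bsub>\<chi>\<^esub> E) (g(k := s), e) (Act 0 # v) (g(k := s''), e)"
    by (blast intro: exec.exec_Cons)
  moreover have "visible (Act 0 # v) = []"
    using \<open>visible v = []\<close> by (simp add: visible_def)
  ultimately show ?case by blast
qed

lemma exec_silent_right:
  fixes L :: "('s, ('io, 'a::zero) label) lts"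
    and \<chi> :: "('io, 'a) label option \<Rightarrow> ('io2, 'b::zero) label option \<Rightarrow> ('io3, 'c::zero) label option"
  assumes "exec E e w e'" "visible w = []" "respects_silent \<chi>"
  shows "\<exists>v. visible v = [] \<and> exec (L \<parallel>\<^bsub>\<chi>\<^esub> E) (g, e) v (g, e')"
  using assms
proof (induction rule: exec.induct)
  case (exec_Nil s)
  then show ?case by (auto intro!: exI[of _ "[]"] simp: visible_def)
next
  case (exec_Cons s a s' w s'')
  then have a: "a = Act 0" and w: "visible w = []"
    by (auto simp: visible_def split: if_splits)
  have "step (L \<parallel>\<^bsub>\<chi>\<^esub> E) (g, s) (Act 0) (g, s')"
    unfolding step_sync_product
    using exec_Cons.hyps exec_Cons.prems a
    by (intro exI[of _ None] exI[of _ "Some (Act 0)"]) (auto simp: respects_silent_def)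
  moreover obtain v where "visible v = []" "exec (L \<parallel>\<^bsub>\<chi>\<^esub> E) (g, s') v (g, s'')"
    using exec_Cons.IH exec_Cons.prems w by auto
  ultimately show ?case
    by (intro exI[of _ "Act 0 # v"]) (auto intro: exec.intros simp: visible_def)
qed

text \<open>
  Silent steps preceding the next visible label of a component are executed just before it is
  needed, so that only the component taking part in the next event has to move.
\<close>

lemma exec_sync_productI:
  fixes L :: "'k \<Rightarrow> ('s, ('io, 'a::zero) label) lts"
    and E :: "('e, ('io2, 'b::zero) label) lts"
    and \<chi> :: "('io, 'a) label option \<Rightarrow> ('io2, 'b) label option \<Rightarrow> ('io3, 'c::zero) label option"
  assumes \<chi>: "respects_silent \<chi>"
  shows "produces \<chi> J xs w \<Longrightarrow>
    (\<And>k. k \<in> J \<Longrightarrow> \<exists>t s'. exec (L k) (g k) t s' \<and> visible t = visible (comp_trace k xs)) \<Longrightarrow>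
    \<exists>t e'. exec E e t e' \<and> visible t = visible (env_trace xs) \<Longrightarrow>
    \<exists>v st. exec (Interleave J L \<parallel>\<^bsub>\<chi>\<^esub> E) (g, e) v st \<and> actions v = actions w"
proof (induction xs arbitrary: w g e)
  case Nil
  then show ?case by (auto intro!: exI[of _ "[]"] exec.intros simp: produces_def)
next
  case (Cons x xs)
  let ?P = "Interleave J L \<parallel>\<^bsub>\<chi>\<^esub> E"
  from Cons.prems(1) obtain c w' where w: "w = c # w'" and xs: "produces \<chi> J xs w'"
    and c: "\<chi> (map_option snd (fst x)) (snd x) = Some c" and J: "fst ` set_option (fst x) \<subseteq> J"
    by (auto simp: produces_def list_all2_Cons1)
  show ?case
  proof (cases "map_option snd (fst x) = Some (Act 0) \<or> snd x = Some (Act 0)")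
    \<comment> \<open>The other side skips in such an event, so nothing visible changes on either
      side; the event is dropped and the rest of the schedule is realized from the same
      states.\<close>
    case True
    then have "c = Act 0"
      using c silent_left[OF \<chi>, of "snd x" c]
        silent_right[OF \<chi>, of "map_option snd (fst x)" c] by auto
    moreover have "visible (comp_trace k (x # xs)) = visible (comp_trace k xs)" for k
      using True c silent_left[OF \<chi>, of "snd x" c]
        silent_right[OF \<chi>, of "map_option snd (fst x)" c]
      by (auto simp: visible_def split: option.splits)
    moreover have "visible (env_trace (x # xs)) = visible (env_trace xs)"
      using True c silent_left[OF \<chi>, of "snd x" c]
        silent_right[OF \<chi>, of "map_option snd (fst x)" c]
      by (auto simp: visible_def split: option.splits)
    ultimately show ?thesis
      using Cons.IH[OF xs, of g e] Cons.prems(2,3) w by simp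
  next
    case False
    have "\<exists>g' v g''. visible v = [] \<and> exec ?P (g, e) v (g', e)
        \<and> step_or_skip (Interleave J L) g' (map_option snd (fst x)) g''
        \<and> (\<forall>k\<in>J. \<exists>t s'. exec (L k) (g'' k) t s' \<and> visible t = visible (comp_trace k xs))"
    proof (cases "fst x")
      case None
      then show ?thesis
        using Cons.prems(2)
        by (intro exI[of _ g] exI[of _ "[]"])
           (auto simp: visible_def)
    next
      case (Some p)
      obtain k a where p: "p = (k, a)"
        by force
      have "k \<in> J" and a: "a \<noteq> Act 0"
        using J False Some p by auto
      have "visible (comp_trace k (x # xs)) = a # visible (comp_trace k xs)"
        using Some p a by (simp add: visible_def)
      then obtain t s' where t: "exec (L k) (g k) t s'" "visible t = a # visible (comp_trace k xs)"
        using Cons.prems(2)[OF \<open>k \<in> J\<close>] by auto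
      then obtain t1 t2 where t12: "t = t1 @ a # t2" "visible t1 = []"
        "visible t2 = visible (comp_trace k xs)"
        by (auto elim: visible_eq_ConsD)
      obtain s1 s2 where s: "exec (L k) (g k) t1 s1" "step (L k) s1 a s2" "exec (L k) s2 t2 s'"
        using t(1) t12(1) by (auto dest!: exec_appendD elim: exec.cases)
      obtain v where v: "visible v = []" "exec ?P (g, e) v (g(k := s1), e)"
        using exec_silent_left[of L k "g k" t1 s1 \<chi> J E g e] s(1) t12(2) \<chi> \<open>k \<in> J\<close>
        by auto
      have "step_or_skip (Interleave J L) (g(k := s1)) (Some a) (g(k := s2))"
        using s(2) \<open>k \<in> J\<close> by auto
      moreover have "\<exists>t s'. exec (L j) ((g(k := s2)) j) t s' \<and> visible t = visible (comp_trace j xs)"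
        if "j \<in> J" for j
        using Cons.prems(2)[OF that] s(3) t12(3) Some p by (auto simp: visible_def)
      ultimately show ?thesis
        using v Some p by (intro exI[of _ "g(k := s1)"] exI[of _ v] exI[of _ "g(k := s2)"]) auto
    qed
    then obtain g' v g'' where v: "visible v = []" "exec ?P (g, e) v (g', e)"
      and g: "step_or_skip (Interleave J L) g' (map_option snd (fst x)) g''"
        "\<And>k. k \<in> J \<Longrightarrow> \<exists>t s'. exec (L k) (g'' k) t s' \<and> visible t = visible (comp_trace k xs)"
      by blast
    have "\<exists>e' u e''. visible u = [] \<and> exec ?P (g', e) u (g', e')
        \<and> step_or_skip E e' (snd x) e''
        \<and> (\<exists>t s'. exec E e'' t s' \<and> visible t = visible (env_trace xs))"
    proof (cases "snd x")
      case None
      then show ?thesis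
        using Cons.prems(3)
        by (intro exI[of _ e] exI[of _ "[]"])
           (auto simp: visible_def)
    next
      case (Some b)
      then have "visible (env_trace (x # xs)) = b # visible (env_trace xs)"
        using False by (simp add: visible_def)
      then obtain t s' where t: "exec E e t s'" "visible t = b # visible (env_trace xs)"
        using Cons.prems(3) by auto
      then obtain t1 t2 where t12: "t = t1 @ b # t2" "visible t1 = []"
        "visible t2 = visible (env_trace xs)"
        by (auto elim: visible_eq_ConsD)
      obtain s1 s2 where s: "exec E e t1 s1" "step E s1 b s2" "exec E s2 t2 s'"
        using t(1) t12(1) by (auto dest!: exec_appendD elim: exec.cases)
      obtain u where "visible u = []" "exec ?P (g', e) u (g', s1)"
        using exec_silent_right[OF s(1) t12(2) \<chi>, of "Interleave J L" g'] by auto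
      moreover have "step_or_skip E s1 (snd x) s2"
        using s(2) Some by simp
      ultimately show ?thesis
        using s(3) t12(3) by blast
    qed
    then obtain e' u e'' where u: "visible u = []" "exec ?P (g', e) u (g', e')"
      and e: "step_or_skip E e' (snd x) e''"
        "\<exists>t s'. exec E e'' t s' \<and> visible t = visible (env_trace xs)"
      by blast
    have "step ?P (g', e') c (g'', e'')"
      using c g(1) e(1) by (auto simp: step_sync_product)
    moreover obtain v' st where v': "exec ?P (g'', e'') v' st" "actions v' = actions w'"
      using Cons.IH[OF xs g(2) e(2)] by blast
    ultimately have "exec ?P (g, e) (v @ u @ c # v') st"
      using v(2) u(2) by (auto intro!: exec_append exec_Cons)
    moreover have "actions (c # v') = actions w"
      using v'(2) w by (cases c) auto
    then have "actions (v @ u @ c # v') = actions w"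
      using v(1) u(1) by (simp add: actions_silent)
    ultimately show ?thesis by blast
  qed
qed

text \<open>The schedule of a left-hand run is reused with its labels mapped by \<open>f\<close> and
  \<open>f'\<close>; it produces the same word under \<open>\<chi>\<close>. Placing the relabelings
  in the synchronization function matches the shape of \<open>chi_impl\<close>.\<close>

lemma action_trace_incl_sync_product:
  fixes L1 :: "'k \<Rightarrow> ('s, 'l) lts" and L2 :: "'k \<Rightarrow> ('s2, ('io, 'a::zero) label) lts"
    and E1 :: "('e, 'm) lts" and E2 :: "('e2, ('io2, 'b::zero) label) lts"
    and \<chi> :: "('io, 'a) label option \<Rightarrow> ('io2, 'b) label option \<Rightarrow> ('io3, 'c::zero) label option"
  assumes \<chi>: "respects_silent \<chi>"
    and L: "\<And>k. k \<in> J \<Longrightarrow> relabel f (L1 k) \<preceq> L2 k"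
    and E: "relabel f' E1 \<preceq> E2"
  shows "(Interleave J L1 \<parallel>\<^bsub>\<lambda>e e'. \<chi> (map_option f e) (map_option f' e')\<^esub> E1)
    \<preceq>\<^sub>t (Interleave J L2 \<parallel>\<^bsub>\<chi>\<^esub> E2)"
  unfolding action_trace_incl_def
proof clarify
  fix w assume "w \<in> traces (Interleave J L1 \<parallel>\<^bsub>\<lambda>e e'. \<chi> (map_option f e) (map_option f' e')\<^esub> E1)"
  then obtain xs where "produces (\<lambda>e e'. \<chi> (map_option f e) (map_option f' e')) J xs w"
    and L1: "\<And>k. comp_trace k xs \<in> traces (L1 k)" and E1: "env_trace xs \<in> traces E1"
    by (fastforce simp: traces_def dest!: exec_sync_productD)
  define ys where "ys = map (map_prod (map_option (map_prod id f)) (map_option f')) xs"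
  have "produces \<chi> J ys w"
    using \<open>produces _ J xs w\<close>
    unfolding ys_def produces_def list_all2_map1
    by (elim list_all2_mono) (auto simp: option.map_comp comp_def option.set_map image_iff)
  moreover have "comp_trace k ys = map f (comp_trace k xs)" for k
    unfolding ys_def by (induction xs) (auto split: option.splits)
  with L1 L have "\<exists>t s'. exec (L2 k) (init (L2 k)) t s' \<and> visible t = visible (comp_trace k ys)"
    if "k \<in> J" for k
    using L[OF that] unfolding trace_incl_def traces_relabel
    by (fastforce simp: image_subset_iff traces_def[of "L2 k"])
  moreover have "env_trace ys = map f' (env_trace xs)"
    unfolding ys_def by (induction xs) (auto split: option.splits)
  with E1 E have "\<exists>t s'. exec E2 (init E2) t s' \<and> visible t = visible (env_trace ys)"
    unfolding trace_incl_def traces_relabel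
    by (fastforce simp: image_subset_iff traces_def[of E2])
  ultimately have
    "\<exists>v st. exec (Interleave J L2 \<parallel>\<^bsub>\<chi>\<^esub> E2) (\<lambda>k. init (L2 k), init E2) v st
      \<and> actions v = actions w"
    using exec_sync_productI[OF \<chi>, of J ys w L2 "\<lambda>k. init (L2 k)" E2 "init E2"] by blast
  then obtain v st where
    "exec (Interleave J L2 \<parallel>\<^bsub>\<chi>\<^esub> E2) (init (Interleave J L2 \<parallel>\<^bsub>\<chi>\<^esub> E2)) v st"
    "actions v = actions w"
    by auto
  then show "actions w \<in> actions ` traces (Interleave J L2 \<parallel>\<^bsub>\<chi>\<^esub> E2)"
    unfolding traces_def by (intro rev_image_eqI[of v]) (blast, simp)
qed


section \<open>Rule application\<close>

abbreviation linear :: "('p \<Rightarrow> bool) \<Rightarrow> ('i, 'p, 't) fact multiset \<Rightarrow> ('i, 'p, 't) fact multiset" where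
  "linear P \<equiv> filter_mset (\<lambda>f. \<not> persistent P (sym f))"

text \<open>For a premise \<open>T\<close> this says that a rule is applicable in \<open>S\<close>;
  for a state \<open>T\<close> it is the order of the simulation.\<close>

definition covers ::
  "('p \<Rightarrow> bool) \<Rightarrow> ('i, 'p, 't) fact multiset \<Rightarrow> ('i, 'p, 't) fact multiset \<Rightarrow> bool" where
  "covers P T S \<longleftrightarrow> linear P T \<subseteq># S \<and> set_mset T \<subseteq> set_mset S"

lemma covers_refl [simp]: "covers P S S"
  by (simp add: covers_def multiset_filter_subset)

lemma covers_trans:
  assumes "covers P A B" "covers P B C"
  shows "covers P A C"
proof -
  have "linear P A \<subseteq># linear P B"
    using assms(1) multiset_filter_mono[of "linear P A" B "\<lambda>f. \<not> persistent P (sym f)"]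
    by (simp add: covers_def filter_filter_mset)
  then show ?thesis
    using assms by (auto simp: covers_def intro: subset_mset.order_trans)
qed

lemma covers_mono: "A \<subseteq># B \<Longrightarrow> covers P A B"
  by (simp add: covers_def set_mset_mono subset_mset.order_trans[OF multiset_filter_subset])

lemma covers_add: "covers P A B \<Longrightarrow> covers P A' B' \<Longrightarrow> covers P (A + A') (B + B')"
  by (auto simp: covers_def intro: subset_mset.add_mono)

text \<open>Truncated difference is monotone on linear facts, and firing never removes persistent
  ones; so the order survives the same rule on both sides.\<close>

lemma covers_fire:
  assumes "covers P T S"
  shows "covers P (T - linear P l + r) (S - linear P l + r)"
proof -
  have "linear P (T - linear P l) = linear P T - linear P l"
    by (rule multiset_eqI) simp
  also have "\<dots> \<subseteq># S - linear P l"
    using assms by (simp add: covers_def subseteq_mset_def diff_le_mono)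
  finally have *: "linear P (T - linear P l) \<subseteq># S - linear P l" .
  have "set_mset (T - linear P l) \<subseteq> set_mset (S - linear P l)"
  proof
    fix f assume f: "f \<in># T - linear P l"
    show "f \<in># S - linear P l"
    proof (cases "persistent P (sym f)")
      case True
      then have "count (linear P l) f = 0" by simp
      moreover have "f \<in># S"
        using f assms by (auto simp: covers_def dest: in_diffD)
      ultimately show ?thesis
        by (simp add: in_diff_count)
    next
      case False
      with f have "f \<in># linear P (T - linear P l)"
        unfolding set_mset_filter by blast
      with * show ?thesis by (rule mset_subset_eqD)
    qed
  qed
  with * show ?thesis
    by (auto simp: covers_def intro: subset_mset.add_mono multiset_filter_subset)
qed

text \<open>Describes a synchronization seen from the whole system: one side gives up the linear
  facts of \<open>l\<close> and the other receives all of \<open>l\<close>. The linear part is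
  unchanged, and persistent facts only gain copies, which \<open>covers\<close> ignores.\<close>

lemma covers_restore:
  assumes "covers P l A"
  shows "covers P (A - linear P l + l) A"
proof -
  have "linear P l \<subseteq># linear P A"
    using assms multiset_filter_mono[of "linear P l" A "\<lambda>f. \<not> persistent P (sym f)"]
    by (simp add: covers_def filter_filter_mset)
  then have eq: "linear P (A - linear P l + l) = linear P A"
    by (simp add: filter_filter_mset)
  have "set_mset (A - linear P l + l) \<subseteq> set_mset A"
    unfolding set_mset_union using assms in_diffD[of _ A "linear P l"]
    unfolding covers_def by blast
  then show ?thesis
    unfolding covers_def eq using multiset_filter_subset by blast
qed

lemma step_msr_of:
  "step (msr_of M R) s a s' \<longleftrightarrow> (\<exists>\<rho> \<in> ginsts (sig M) R.
     covers (pers M) (lhs \<rho>) (fst s) \<and> {m. Fact Fr [m] \<in># rhs \<rho>} \<inter> snd s = {} \<and> a = lab \<rho>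
     \<and> fst s' = fst s - linear (pers M) (lhs \<rho>) + rhs \<rho>
     \<and> snd s' = snd s \<union> {m. Fact Fr [m] \<in># rhs \<rho>})"
  by (auto simp: msr_of_def msr_def msr_step_def covers_def Let_def split_beta)

lemma init_msr_of [simp]: "init (msr_of M R) = ({#}, {})"
  by (simp add: msr_of_def msr_def)

fun unbuffer :: "('i, 'p, 't) fact \<Rightarrow> ('i, 'p, 't) fact" where
  "unbuffer (Fact (Buf i F) (t # ts)) = Fact F ts"
| "unbuffer f = f"

lemma persistent_unbuffer [simp]: "persistent P (sym (unbuffer f)) = persistent P (sym f)"
  by (cases f rule: unbuffer.cases) auto

lemma linear_unbuffer: "linear P (image_mset unbuffer A) = image_mset unbuffer (linear P A)"
  by (simp add: filter_mset_image_mset comp_def)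

lemma covers_unbuffer:
  "covers P A B \<Longrightarrow> covers P (image_mset unbuffer A) (image_mset unbuffer B)"
  by (auto simp: covers_def linear_unbuffer image_mset_subseteq_mono)

text \<open>Mapping commutes with multiset difference only if the subtrahend is included, which
  applicability of the rule guarantees; \<open>unbuffer\<close> may identify distinct facts.\<close>

lemma unbuffer_fire:
  assumes "covers P l S"
  shows "image_mset unbuffer (S - linear P l + r) =
    image_mset unbuffer S - linear P (image_mset unbuffer l) + image_mset unbuffer r"
proof -
  have "linear P l \<subseteq># S"
    using assms by (simp add: covers_def)
  then show ?thesis
    unfolding linear_unbuffer by (simp only: image_mset_union image_mset_Diff)
qed


section \<open>Ground instances of the component rules\<close>

lemma ginsts_mono: "A \<subseteq> B \<Longrightarrow> ginsts \<Sigma> A \<subseteq> ginsts \<Sigma> B"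
  by (auto simp: ginsts_def)

lemma sym_map_fact [simp]: "sym (map_fact h f) = sym f"
  by (cases f) simp

lemma eval_set_rid: "eval \<theta> (set_rid rid t) = eval (\<theta>(rid_var := rid)) t"
  by (induction t) auto

text \<open>The assumption excludes facts that already carry a \<open>Buf\<close> symbol: they would
  be stripped without having been buffered.\<close>

lemma unbuffer_buffer:
  assumes "is_input (sym f) \<or> is_output (sym f) \<or> sym f \<in> range (State i)"
  shows "unbuffer (map_fact (eval \<theta>) (buffer i' rid (map_fact (set_rid rid) f)))
    = map_fact (eval (\<theta>(rid_var := rid))) f"
  using assms by (cases f) (auto simp: eval_set_rid comp_def)

lemma protocol_model_roleD:
  assumes "protocol_model M" "\<rho> \<in> role_rules M i"
  shows "\<forall>f \<in># lhs \<rho>. is_input (sym f) \<or> role_state_fact i f"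
    "\<forall>f \<in># rhs \<rho>. is_output (sym f) \<or> role_state_fact i f" "lab \<rho> \<in> range Act"
  using assms unfolding protocol_model_def by blast+

lemma protocol_model_envD:
  assumes "protocol_model M" "\<rho> \<in> env_rules M"
  shows "\<forall>f \<in># lhs \<rho> + rhs \<rho>. is_env (sym f)" "lab \<rho> \<in> range Act"
  using assms unfolding protocol_model_def by blast+

text \<open>Undoing the buffering of a protocol rule gives an instance of the original role rule,
  with the run identifier moved into the substitution. It generates no name, because
  \<open>Fr\<close> is an input symbol and cannot occur in a role conclusion.\<close>

lemma role_run_ginstsE:
  assumes M: "protocol_model M" and rid: "rid \<in> runs M"
    and \<rho>: "\<rho> \<in> ginsts (sig M) (role_run_rules M i rid)"
  obtains (role) \<rho>' where "\<rho>' \<in> ginsts (sig M) (role_rules M i)"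
      "lhs \<rho>' = image_mset unbuffer (lhs \<rho>)" "rhs \<rho>' = image_mset unbuffer (rhs \<rho>)"
      "lab \<rho>' = lab \<rho>" "lab \<rho> \<in> range Act" "\<And>ts. Fact Fr ts \<notin># rhs \<rho>'"
  | (send) F xs where "is_output F"
      "\<rho> = Rule {#Fact (Buf i F) (rid # xs)#} (IO (Lam Sys F i rid xs)) {#}"
  | (receive) F xs where "is_input F"
      "\<rho> = Rule {#} (IO (Lam Sys F i rid xs)) {#Fact (Buf i F) (rid # xs)#}"
proof -
  obtain \<rho>0 \<theta> where \<rho>0: "\<rho>0 \<in> role_run_rules M i rid" "ground_subst (sig M) \<theta>"
    "\<rho> = map_rule (eval \<theta>) \<rho>0"
    using \<rho> by (auto simp: ginsts_def)
  from \<rho>0(1) consider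
      \<rho>1 where "\<rho>1 \<in> role_rules M i" "\<rho>0 = buffer_rule i rid (map_rule (set_rid rid) \<rho>1)"
    | F n where "is_output F"
        "\<rho>0 = Rule {#Fact (Buf i F) (Cst rid # vars n)#} (IO (Lam Sys F i (Cst rid) (vars n))) {#}"
    | F n where "is_input F"
        "\<rho>0 = Rule {#} (IO (Lam Sys F i (Cst rid) (vars n))) {#Fact (Buf i F) (Cst rid # vars n)#}"
    unfolding role_run_rules_def by blast
  then show ?thesis
  proof cases
    case 1
    obtain l a r where \<rho>1: "\<rho>1 = Rule l a r" by (cases \<rho>1)
    let ?\<theta> = "\<theta>(rid_var := rid)"
    have lr: "\<forall>f \<in># l. is_input (sym f) \<or> role_state_fact i f"
        "\<forall>f \<in># r. is_output (sym f) \<or> role_state_fact i f" "a \<in> range Act"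
      using protocol_model_roleD[OF M 1(1)] \<rho>1 by simp_all
    then have "is_input (sym f) \<or> is_output (sym f) \<or> sym f \<in> range (State i)"
      if "f \<in># l + r" for f
      using that by (auto simp: role_state_fact_def)
    then have f: "unbuffer (map_fact (eval \<theta>) (buffer i rid (map_fact (set_rid rid) f)))
        = map_fact (eval ?\<theta>) f" if "f \<in># l + r" for f
      using that unbuffer_buffer by metis
    \<comment> \<open>\<open>rid_var\<close> has sort \<open>MsgSort\<close>, so any message may be
      assigned to it.\<close>
    have "ground_subst (sig M) ?\<theta>"
      using M \<rho>0(2) rid by (auto simp: protocol_model_def ground_subst_def rid_var_def)
    then have "map_rule (eval ?\<theta>) \<rho>1 \<in> ginsts (sig M) (role_rules M i)"
      using 1(1) by (auto simp: ginsts_def)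
    moreover have "lhs (map_rule (eval ?\<theta>) \<rho>1) = image_mset unbuffer (lhs \<rho>)"
      "rhs (map_rule (eval ?\<theta>) \<rho>1) = image_mset unbuffer (rhs \<rho>)"
      using \<rho>1 1(2) \<rho>0(3) f
      by (auto simp: multiset.map_comp comp_def intro!: image_mset_cong)
    moreover have "lab (map_rule (eval ?\<theta>) \<rho>1) = lab \<rho>"
      using \<rho>1 1(2) \<rho>0(3) lr(3)
      by (auto simp: multiset.map_comp fact.map_comp comp_def eval_set_rid)
    moreover have "lab \<rho> \<in> range Act"
      using \<rho>1 1(2) \<rho>0(3) lr(3) by auto
    moreover have "Fact Fr ts \<notin># rhs (map_rule (eval ?\<theta>) \<rho>1)" for ts
      using lr(2) \<rho>1 by (auto simp: role_state_fact_def dest!: arg_cong[of _ _ sym])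
    ultimately show ?thesis by (rule role)
  next
    case (2 F n)
    then show ?thesis
      using \<rho>0(3) by (intro send[of F "map (eval \<theta>) (vars n)"]) auto
  next
    case (3 F n)
    then show ?thesis
      using \<rho>0(3) by (intro receive[of F "map (eval \<theta>) (vars n)"]) auto
  qed
qed

lemma env_ind_ginstsE:
  assumes M: "protocol_model M" and \<rho>: "\<rho> \<in> ginsts (sig M) (env_ind_rules M)"
  obtains (env) "\<rho> \<in> ginsts (sig M) (env_rules M)" "lab \<rho> \<in> range Act"
      "\<forall>f \<in># lhs \<rho> + rhs \<rho>. is_env (sym f)"
  | (send) F i rid xs where "is_output F"
      "\<rho> = Rule {#} (IO (Lam Env F i rid xs)) {#Fact F xs#}"
  | (receive) F i rid xs where "is_input F"
      "\<rho> = Rule {#Fact F xs#} (IO (Lam Env F i rid xs)) {#}"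
  | (ind) d rid x where "lab \<rho> = IO (LamInd Env d rid x)" "\<forall>f \<in># rhs \<rho>. sym f = OutInd"
proof -
  obtain \<rho>0 \<theta> where \<rho>0: "\<rho>0 \<in> env_ind_rules M" "ground_subst (sig M) \<theta>"
    "\<rho> = map_rule (eval \<theta>) \<rho>0"
    using \<rho> by (auto simp: ginsts_def)
  obtain l a r where lar: "\<rho>0 = Rule l a r" by (cases \<rho>0)
  from \<rho>0(1) consider
      "\<rho>0 \<in> env_rules M"
    | F i rid n where "is_output F"
        "\<rho>0 = Rule {#} (IO (Lam Env F i (Cst rid) (vars n))) {#Fact F (vars n)#}"
    | F i rid n where "is_input F"
        "\<rho>0 = Rule {#Fact F (vars n)#} (IO (Lam Env F i (Cst rid) (vars n))) {#}"
    | d rid x where "a = IO (LamInd Env d rid x)" "\<forall>f \<in># r. sym f = OutInd"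
    unfolding env_ind_rules_def env_sync_rules_def lar by auto
  then show ?thesis
  proof cases
    case 1
    then have "\<forall>f \<in># l + r. is_env (sym f)" "a \<in> range Act"
      using protocol_model_envD[OF M] lar by force+
    then have "\<forall>f \<in># lhs \<rho> + rhs \<rho>. is_env (sym f)" "lab \<rho> \<in> range Act"
      using \<rho>0(3) lar by auto
    moreover have "\<rho> \<in> ginsts (sig M) (env_rules M)"
      using 1 \<rho>0 by (auto simp: ginsts_def)
    ultimately show ?thesis by (intro env)
  next
    case (2 F i rid n)
    then show ?thesis
      using \<rho>0(3) by (intro send[of F i rid "map (eval \<theta>) (vars n)"]) auto
  next
    case (3 F i rid n)
    then show ?thesis
      using \<rho>0(3) by (intro receive[of F "map (eval \<theta>) (vars n)" i rid]) auto
  next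
    case (4 d rid x)
    then show ?thesis
      using \<rho>0(3) lar by (intro ind[of d "eval \<theta> rid" "eval \<theta> x"]) auto
  qed
qed

lemma lab_ind_ginsts:
  assumes "\<rho> \<in> ginsts (sig M) (ind_rules M rid)"
  shows "lab \<rho> = silent \<or> (\<exists>d r x. lab \<rho> = IO (LamInd Sys d r x))"
  using assms by (auto simp: ginsts_def ind_rules_def)

lemma chi_plus_SomeE:
  assumes "chi_plus e e' = Some c"
  obtains (ind) d rid x where "e = Some (IO (LamInd Sys d rid x))"
      "e' = Some (IO (LamInd Env d rid x))" "c = silent"
  | (sync) F i rid xs where "e = Some (IO (Lam Sys F i rid xs))"
      "e' = Some (IO (Lam Env F i rid xs))" "c = silent"
  | (left) a where "e = Some (Act a)" "e' = None" "c = Act a"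
  | (right) a where "e = None" "e' = Some (Act a)" "c = Act a"
  using assms unfolding chi_plus_def
  by (cases "(e, e')" rule: chi.cases) (auto split: if_splits)

lemma respects_silent_chi_plus: "respects_silent (chi_plus :: ('i, 'p, 't) mlabel option \<Rightarrow> _)"
proof -
  have "chi_plus (Some silent) e = (if e = None then Some silent else None)"
    "chi_plus e (Some silent) = (if e = None then Some silent else None)"
    for e :: "('i, 'p, 't) mlabel option"
    by (cases "(Some silent :: ('i, 'p, 't) mlabel option, e)" rule: chi.cases,
        auto simp: chi_plus_def)
  then show ?thesis
    by (simp add: respects_silent_def)
qed


section \<open>Simulation of the decomposed system\<close>

type_synonym ('i, 'p, 'f) msr_state = "('i, 'p, 'f msg) fact multiset \<times> 'f msg set"

type_synonym ('i, 'p, 'f) product_state =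
  "('i \<times> 'f msg \<Rightarrow> ('i, 'p, 'f) msr_state \<times> ('i, 'p, 'f) msr_state) \<times> ('i, 'p, 'f) msr_state"

abbreviation held ::
  "('i, 'p, 'f) msr_state \<times> ('i, 'p, 'f) msr_state \<Rightarrow> ('i, 'p, 'f msg) fact multiset" where
  "held x \<equiv> image_mset unbuffer (fst (fst x))"

abbreviation env_part :: "('i, 'p, 't) fact multiset \<Rightarrow> ('i, 'p, 't) fact multiset" where
  "env_part \<equiv> filter_mset (\<lambda>f. is_env (sym f))"

text \<open>
  The simulation is by inclusion: the second state of each pair (that of \<open>ind_rules\<close>) and the
  facts reserved for protocol-independent I/O are ignored, and the protocol keeps a name that such
  an operation takes from the environment.  The finite set \<open>A\<close> contains the runs that have started.
\<close>

definition simulates :: "('p \<Rightarrow> bool) \<Rightarrow> ('i, 'p, 'f) product_state \<Rightarrow> ('i, 'p, 'f) msr_state \<Rightarrow> bool"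
  where "simulates P st s \<longleftrightarrow> snd s = snd (snd st) \<and>
    (\<exists>A. finite A \<and> (\<forall>k. k \<notin> A \<longrightarrow> held (fst st k) = {#}) \<and>
      covers P (env_part (fst (snd st)) + (\<Sum>k\<in>A. held (fst st k))) (fst s))"

text \<open>Isolates one component: \<open>C\<close> is the joint contribution of all others, fixed
  while component \<open>k\<close> and the environment change. The last property closes the
  invariant again, with \<open>k\<close> counted among the started runs.\<close>

lemma simulatesE:
  assumes "simulates P (g, e) s"
  obtains C where "snd s = snd e" "covers P (env_part (fst e) + held (g k) + C) (fst s)"
    "\<And>x e' s'. snd s' = snd e' \<Longrightarrow> covers P (env_part (fst e') + held x + C) (fst s') \<Longrightarrow>
       simulates P (g(k := x), e') s'"
proof -
  obtain A where A: "finite A" "\<And>j. j \<notin> A \<Longrightarrow> held (g j) = {#}"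
    "covers P (env_part (fst e) + (\<Sum>j\<in>A. held (g j))) (fst s)" "snd s = snd e"
    using assms by (auto simp: simulates_def)
  define C where "C = (\<Sum>j\<in>A - {k}. held (g j))"
  \<comment> \<open>If \<open>k\<close> has not started, its share is empty and the equation still
    holds.\<close>
  have "(\<Sum>j\<in>A. held (g j)) = held (g k) + C"
    using A(1) A(2)[of k] by (cases "k \<in> A") (simp_all add: C_def sum.remove)
  moreover have "simulates P (g(k := x), e') s'"
    if "snd s' = snd e'" "covers P (env_part (fst e') + held x + C) (fst s')" for x e' s'
  proof -
    have "C = (\<Sum>j\<in>A - {k}. held ((g(k := x)) j))"
      by (auto simp: C_def intro: sum.cong)
    then have "(\<Sum>j\<in>insert k A. held ((g(k := x)) j)) = held x + C"
      using A(1) by (subst sum.insert_remove) simp_all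
    with that A(1,2) show ?thesis
      unfolding simulates_def
      by (intro conjI exI[of _ "insert k A"]) (simp_all add: add.assoc)
  qed
  moreover have "covers P (env_part (fst e) + held (g k) + C) (fst s)"
    using A(3) calculation(1) by (simp add: add.assoc)
  ultimately show ?thesis
    using A(4) that by blast
qed

lemma env_part_fire:
  assumes "\<forall>f \<in># l + r. is_env (sym f)"
  shows "env_part (S - linear P l + r) = env_part S - linear P l + r"
  using assms by (auto intro!: multiset_eqI simp: count_eq_zero_iff)

lemma covers_env_part:
  assumes "\<forall>f \<in># l. is_env (sym f)" "covers P l S"
  shows "covers P l (env_part S)"
proof -
  have "env_part (linear P l) \<subseteq># env_part S"
    using assms(2) by (intro multiset_filter_mono) (simp add: covers_def)
  moreover have "env_part (linear P l) = linear P l"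
    using assms(1) by (auto intro!: filter_mset_eq_conv[THEN iffD2] simp: filter_mset_eq_conv)
  ultimately show ?thesis
    using assms by (auto simp: covers_def)
qed

lemma protocol_ginsts:
  "ginsts (sig M) (env_rules M) \<subseteq> ginsts (sig M) (protocol_rules M)"
  "ginsts (sig M) (role_rules M i) \<subseteq> ginsts (sig M) (protocol_rules M)"
  by (auto simp: protocol_rules_def intro!: ginsts_mono)

text \<open>Each role component shares an index with its \<open>ind_rules\<close>, since the
  verifier assumption bounds a program by both together.\<close>

abbreviation decomposed where
  "decomposed M \<equiv> Interleave (UNIV \<times> runs M)
      (\<lambda>(i, rid). msr_of M (role_run_rules M i rid) ||| msr_of M (ind_rules M rid))
    \<parallel>\<^bsub>chi_plus\<^esub> msr_of M (env_ind_rules M)"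

text \<open>Firing a rule inside one part agrees with firing it in the whole state, provided the
  consumed facts lie in that part.\<close>

lemma diff_add_add_mset:
  assumes "l \<subseteq># A"
  shows "A - l + r + B = A + B - l + (r :: 'a multiset)"
proof -
  obtain D where "A = l + D"
    using assms by (auto simp: mset_subset_eq_exists_conv)
  then show ?thesis by (simp add: ac_simps)
qed

lemma decomposed_step:
  fixes M :: "('i, 'p, 'f) model"
  assumes M: "protocol_model M" and st: "step (decomposed M) st c st'"
    and sim: "simulates (pers M) st s"
  shows "\<exists>s'. simulates (pers M) st' s'
    \<and> (c = silent \<and> s' = s \<or> step (msr_of M (protocol_rules M)) s c s')"
proof -
  obtain g e where ge: "st = (g, e)" by (rule prod.exhaust)
  obtain g' e' where ge': "st' = (g', e')" by (rule prod.exhaust)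
  note sim = sim[unfolded ge]
  let ?P = "pers M"
  let ?env = "msr_of M (env_ind_rules M)"
  let ?role = "\<lambda>i rid. msr_of M (role_run_rules M i rid)"
  let ?ind = "\<lambda>rid. msr_of M (ind_rules M rid)"
  have comp: "\<exists>i rid x. rid \<in> runs M \<and> g' = g((i, rid) := x)
      \<and> (step (?role i rid) (fst (g (i, rid))) a (fst x) \<and> snd x = snd (g (i, rid))
        \<or> step (?ind rid) (snd (g (i, rid))) a (snd x) \<and> fst x = fst (g (i, rid)))"
    if Step: "step_or_skip (Interleave (UNIV \<times> runs M) (\<lambda>(i, rid). ?role i rid ||| ?ind rid)) g (Some a) g'"
    for a
  proof -
    obtain k x where k: "k \<in> UNIV \<times> runs M" "g' = g(k := x)"
      "step (case k of (i, rid) \<Rightarrow> ?role i rid ||| ?ind rid) (g k) a x"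
      using Step unfolding step_or_skip_simps step_Interleave by blast
    obtain i rid where "k = (i, rid)"
      by (rule prod.exhaust)
    with k have "rid \<in> runs M" "g' = g((i, rid) := x)"
      "step (?role i rid ||| ?ind rid) (g (i, rid)) a x"
      by simp_all
    then show ?thesis
      unfolding step_interleave by blast
  qed
  obtain l l' where c: "chi_plus l l' = Some c"
    and l: "step_or_skip (Interleave (UNIV \<times> runs M) (\<lambda>(i, rid). ?role i rid ||| ?ind rid)) g l g'"
    and l': "step_or_skip ?env e l' e'"
    using st unfolding ge ge' step_sync_product fst_conv snd_conv by blast
  from c show ?thesis
  proof (cases rule: chi_plus_SomeE)
    case (ind d rid0 y)
    from comp[OF l[unfolded ind(1)]] obtain i rid x where x: "rid \<in> runs M"
      "g' = g((i, rid) := x)"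
      "step (?role i rid) (fst (g (i, rid))) (IO (LamInd Sys d rid0 y)) (fst x) \<or>
        fst x = fst (g (i, rid))"
      by blast
    \<comment> \<open>Role components have no \<open>LamInd\<close> labels, so only the
      \<open>ind_rules\<close> half can have moved.\<close>
    have fst: "fst x = fst (g (i, rid))"
      using x(3) by (auto simp: step_msr_of dest: sym elim!: role_run_ginstsE[OF M x(1)])
    obtain \<rho> where \<rho>: "\<rho> \<in> ginsts (sig M) (env_ind_rules M)" "lab \<rho> = IO (LamInd Env d rid0 y)"
      "fst e' = fst e - linear ?P (lhs \<rho>) + rhs \<rho>"
      "snd e' = snd e \<union> {m. Fact Fr [m] \<in># rhs \<rho>}"
      using l' ind(2) by (auto simp: step_msr_of)
    have r: "\<forall>f \<in># rhs \<rho>. sym f = OutInd"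
      using \<rho>(1) by (rule env_ind_ginstsE[OF M]) (use \<rho>(2) in auto)
    \<comment> \<open>\<open>OutInd\<close> is neither an environment symbol nor \<open>Fr\<close>:
      the environment part gains nothing and no name is generated.\<close>
    then have r': "env_part (rhs \<rho>) = {#}" and "snd e' = snd e"
      using \<rho>(4) by (auto simp: is_env_def count_eq_zero_iff intro!: multiset_eqI)
    \<comment> \<open>An inclusion only, because \<open>FrOp\<close> consumes an \<open>Fr\<close>
      fact.\<close>
    have "env_part (fst e') \<subseteq># env_part (fst e)"
      unfolding \<rho>(3) filter_union_mset r' by simp
    from sim show ?thesis
    proof (rule simulatesE[where k = "(i, rid)"])
      fix C assume C: "snd s = snd e"
        "covers ?P (env_part (fst e) + held (g (i, rid)) + C) (fst s)"
        "\<And>x e' s'. snd s' = snd e' \<Longrightarrow> covers ?P (env_part (fst e') + held x + C) (fst s') \<Longrightarrow>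
          simulates ?P (g((i, rid) := x), e') s'"
      have "covers ?P (env_part (fst e') + held x + C) (fst s)"
        using fst \<open>env_part (fst e') \<subseteq># _\<close>
        by (intro covers_trans[OF covers_mono C(2)]) simp
      then have "simulates ?P st' s"
        unfolding ge' x(2) using C(1,3) \<open>snd e' = snd e\<close> by simp
      then show ?thesis using ind(3) by blast
    qed
  next
    case (sync F i0 rid0 xs)
    from comp[OF l[unfolded sync(1)]] obtain i rid x where x: "rid \<in> runs M"
      "g' = g((i, rid) := x)"
      "step (?role i rid) (fst (g (i, rid))) (IO (Lam Sys F i0 rid0 xs)) (fst x) \<or>
        step (?ind rid) (snd (g (i, rid))) (IO (Lam Sys F i0 rid0 xs)) (snd x)"
      by blast
    have "\<not> step (?ind rid) (snd (g (i, rid))) (IO (Lam Sys F i0 rid0 xs)) (snd x)"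
      by (auto simp: step_msr_of dest!: lab_ind_ginsts)
    with x(3) obtain \<rho> where \<rho>: "\<rho> \<in> ginsts (sig M) (role_run_rules M i rid)"
      "lab \<rho> = IO (Lam Sys F i0 rid0 xs)" "covers ?P (lhs \<rho>) (fst (fst (g (i, rid))))"
      "fst (fst x) = fst (fst (g (i, rid))) - linear ?P (lhs \<rho>) + rhs \<rho>"
      by (auto simp: step_msr_of)
    obtain \<eta> where \<eta>: "\<eta> \<in> ginsts (sig M) (env_ind_rules M)"
      "lab \<eta> = IO (Lam Env F i0 rid0 xs)" "covers ?P (lhs \<eta>) (fst e)"
      "fst e' = fst e - linear ?P (lhs \<eta>) + rhs \<eta>"
      "snd e' = snd e \<union> {m. Fact Fr [m] \<in># rhs \<eta>}"
      using l' sync(2) by (auto simp: step_msr_of)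
    have held: "held x = held (g (i, rid)) - linear ?P (image_mset unbuffer (lhs \<rho>))
        + image_mset unbuffer (rhs \<rho>)"
      unfolding \<rho>(4) using \<rho>(3) by (rule unbuffer_fire)
    let ?f = "Fact F xs"
    have \<rho>': "is_output F \<and> image_mset unbuffer (lhs \<rho>) = {#?f#} \<and> rhs \<rho> = {#} \<or>
        is_input F \<and> lhs \<rho> = {#} \<and> image_mset unbuffer (rhs \<rho>) = {#?f#}"
      using \<rho>(1) by (rule role_run_ginstsE[OF M x(1)]) (use \<rho>(2) in auto)
    have \<eta>': "is_output F \<and> lhs \<eta> = {#} \<and> rhs \<eta> = {#?f#} \<or>
        is_input F \<and> lhs \<eta> = {#?f#} \<and> rhs \<eta> = {#}"
      using \<eta>(1) by (rule env_ind_ginstsE[OF M]) (use \<eta>(2) in auto)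
    \<comment> \<open>Forces both sides to agree on the direction in which the fact travels.\<close>
    have "is_env F" "\<not> (is_input F \<and> is_output F)"
      using \<rho>' by (auto simp: is_env_def elim: is_output.elims is_input.elims)
    have "snd e' = snd e"
      using \<eta>(5) \<eta>' by auto
    have env: "env_part (fst e') = env_part (fst e) - linear ?P (lhs \<eta>) + rhs \<eta>"
      unfolding \<eta>(4) using \<eta>' \<open>is_env F\<close> by (intro env_part_fire) auto
    have covers_env: "covers ?P (lhs \<eta>) (env_part (fst e))"
      using \<eta>(3) \<eta>' \<open>is_env F\<close> by (intro covers_env_part) auto
    have covers_held: "covers ?P (image_mset unbuffer (lhs \<rho>)) (held (g (i, rid)))"
      using \<rho>(3) by (rule covers_unbuffer)
    have transfer: "covers ?P (env_part (fst e') + held x) (env_part (fst e) + held (g (i, rid)))"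
    proof (cases "is_output F")
      case True
      with \<rho>' \<eta>' \<open>\<not> (_ \<and> _)\<close> have *: "image_mset unbuffer (lhs \<rho>) = {#?f#}" "rhs \<rho> = {#}"
        "lhs \<eta> = {#}" "rhs \<eta> = {#?f#}" by auto
      show ?thesis
        using covers_add[OF covers_restore[OF covers_held] covers_refl[of ?P "env_part (fst e)"]]
        unfolding held env * by (simp add: ac_simps)
    next
      case False
      with \<rho>' \<eta>' have *: "lhs \<rho> = {#}" "image_mset unbuffer (rhs \<rho>) = {#?f#}"
        "lhs \<eta> = {#?f#}" "rhs \<eta> = {#}" by auto
      show ?thesis
        using covers_add[OF covers_restore[OF covers_env] covers_refl[of ?P "held (g (i, rid))"]]
        unfolding held env * by (simp add: ac_simps)
    qed
    from sim show ?thesis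
    proof (rule simulatesE[where k = "(i, rid)"])
      fix C assume C: "snd s = snd e"
        "covers ?P (env_part (fst e) + held (g (i, rid)) + C) (fst s)"
        "\<And>x e' s'. snd s' = snd e' \<Longrightarrow> covers ?P (env_part (fst e') + held x + C) (fst s') \<Longrightarrow>
          simulates ?P (g((i, rid) := x), e') s'"
      have "covers ?P (env_part (fst e') + held x + C) (fst s)"
        using covers_add[OF transfer covers_refl] C(2) by (rule covers_trans)
      then have "simulates ?P st' s"
        unfolding ge' x(2) using C(1,3) \<open>snd e' = snd e\<close> by simp
      then show ?thesis using sync(3) by blast
    qed
  next
    case (left a)
    from comp[OF l[unfolded left(1)]] obtain i rid x where x: "rid \<in> runs M"
      "g' = g((i, rid) := x)"
      "step (?role i rid) (fst (g (i, rid))) (Act a) (fst x) \<or>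
        step (?ind rid) (snd (g (i, rid))) (Act a) (snd x) \<and> fst x = fst (g (i, rid))"
      by blast
    have e': "e' = e" using l' left(2) by simp
    from sim show ?thesis
    proof (rule simulatesE[where k = "(i, rid)"])
      fix C assume C: "snd s = snd e"
        "covers ?P (env_part (fst e) + held (g (i, rid)) + C) (fst s)"
        "\<And>x e' s'. snd s' = snd e' \<Longrightarrow> covers ?P (env_part (fst e') + held x + C) (fst s') \<Longrightarrow>
          simulates ?P (g((i, rid) := x), e') s'"
      from x(3) show ?thesis
      proof
        assume ind: "step (?ind rid) (snd (g (i, rid))) (Act a) (snd x) \<and> fst x = fst (g (i, rid))"
        then have "c = silent"
          unfolding left(3) by (auto simp: step_msr_of dest!: lab_ind_ginsts)
        moreover have "simulates ?P st' s"
          unfolding ge' x(2) e' using ind C by simp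
        ultimately show ?thesis by blast
      next
        assume "step (?role i rid) (fst (g (i, rid))) (Act a) (fst x)"
        then obtain \<rho> where \<rho>: "\<rho> \<in> ginsts (sig M) (role_run_rules M i rid)"
          "lab \<rho> = Act a" "covers ?P (lhs \<rho>) (fst (fst (g (i, rid))))"
          "fst (fst x) = fst (fst (g (i, rid))) - linear ?P (lhs \<rho>) + rhs \<rho>"
          by (auto simp: step_msr_of)
        obtain \<rho>' where \<rho>': "\<rho>' \<in> ginsts (sig M) (role_rules M i)"
          "lhs \<rho>' = image_mset unbuffer (lhs \<rho>)" "rhs \<rho>' = image_mset unbuffer (rhs \<rho>)"
          "lab \<rho>' = lab \<rho>" "\<And>ts. Fact Fr ts \<notin># rhs \<rho>'"
          using \<rho>(1) by (rule role_run_ginstsE[OF M x(1)]) (use \<rho>(2) in auto)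
        have held: "held x = held (g (i, rid)) - linear ?P (lhs \<rho>') + rhs \<rho>'"
          unfolding \<rho>(4) \<rho>' using \<rho>(3) by (rule unbuffer_fire)
        have cov: "covers ?P (lhs \<rho>') (held (g (i, rid)))"
          unfolding \<rho>' using \<rho>(3) by (rule covers_unbuffer)
        let ?T = "env_part (fst e) + held (g (i, rid)) + C"
        let ?s' = "(fst s - linear ?P (lhs \<rho>') + rhs \<rho>', snd s)"
        have "covers ?P (lhs \<rho>') ?T"
          using covers_trans[OF cov covers_mono] by simp
        then have "covers ?P (lhs \<rho>') (fst s)"
          using C(2) by (rule covers_trans)
        \<comment> \<open>Role rules generate no names, so the freshness condition holds trivially
          and the second component of \<open>s\<close> stays.\<close>
        then have "step (msr_of M (protocol_rules M)) s c ?s'"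
          unfolding step_msr_of using \<rho>' \<rho>(2) left(3) protocol_ginsts(2)[of M i]
          by (intro bexI[of _ \<rho>']) auto
        moreover have "env_part (fst e) + held x + C = ?T - linear ?P (lhs \<rho>') + rhs \<rho>'"
          unfolding held using cov diff_add_add_mset[of "linear ?P (lhs \<rho>')" "held (g (i, rid))"
              "rhs \<rho>'" "env_part (fst e) + C"]
          by (simp add: covers_def ac_simps)
        then have "covers ?P (env_part (fst e) + held x + C) (fst ?s')"
          using C(2) by (simp add: covers_fire)
        then have "simulates ?P st' ?s'"
          unfolding ge' x(2) e' using C(1,3) by simp
        ultimately show ?thesis by blast
      qed
    qed
  next
    case (right a)
    have g': "g' = g" using l right(1) by simp
    obtain \<rho> where \<rho>: "\<rho> \<in> ginsts (sig M) (env_ind_rules M)"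
      "lab \<rho> = Act a" "covers ?P (lhs \<rho>) (fst e)" "{m. Fact Fr [m] \<in># rhs \<rho>} \<inter> snd e = {}"
      "fst e' = fst e - linear ?P (lhs \<rho>) + rhs \<rho>"
      "snd e' = snd e \<union> {m. Fact Fr [m] \<in># rhs \<rho>}"
      using l' right(2) by (auto simp: step_msr_of)
    have \<rho>': "\<rho> \<in> ginsts (sig M) (env_rules M)" "\<forall>f \<in># lhs \<rho> + rhs \<rho>. is_env (sym f)"
      using \<rho>(1) by (rule env_ind_ginstsE[OF M]; use \<rho>(2) in auto)+
    have env: "env_part (fst e') = env_part (fst e) - linear ?P (lhs \<rho>) + rhs \<rho>"
      unfolding \<rho>(5) using \<rho>'(2) by (rule env_part_fire)
    have cov: "covers ?P (lhs \<rho>) (env_part (fst e))"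
      using \<rho>(3) \<rho>'(2) by (intro covers_env_part) auto
    from sim show ?thesis
    \<comment> \<open>No component moves here, so any index serves; its state is put back unchanged
      at the end.\<close>
    proof (rule simulatesE[where k = undefined])
      fix C assume C: "snd s = snd e"
        "covers ?P (env_part (fst e) + held (g undefined) + C) (fst s)"
        "\<And>x e' s'. snd s' = snd e' \<Longrightarrow> covers ?P (env_part (fst e') + held x + C) (fst s') \<Longrightarrow>
          simulates ?P (g(undefined := x), e') s'"
      let ?T = "env_part (fst e) + held (g undefined) + C"
      let ?s' = "(fst s - linear ?P (lhs \<rho>) + rhs \<rho>, snd e')"
      have "covers ?P (lhs \<rho>) ?T"
        using covers_trans[OF cov covers_mono] by (simp add: add.assoc)
      then have "covers ?P (lhs \<rho>) (fst s)"
        using C(2) by (rule covers_trans)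
      \<comment> \<open>Freshness carries over because both systems have generated the same
        names.\<close>
      then have "step (msr_of M (protocol_rules M)) s c ?s'"
        unfolding step_msr_of using \<rho>' \<rho> right(3) protocol_ginsts(1)[of M] C(1)
        by (intro bexI[of _ \<rho>]) auto
      moreover have "env_part (fst e') + held (g undefined) + C = ?T - linear ?P (lhs \<rho>) + rhs \<rho>"
        unfolding env using cov diff_add_add_mset[of "linear ?P (lhs \<rho>)" "env_part (fst e)"
            "rhs \<rho>" "held (g undefined) + C"]
        by (simp add: covers_def ac_simps)
      then have "covers ?P (env_part (fst e') + held (g undefined) + C) (fst ?s')"
        using C(2) by (simp add: covers_fire)
      then have "simulates ?P st' ?s'"
        unfolding ge' g' using C(3)[of ?s' e' "g undefined"] by simp
      ultimately show ?thesis by blast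
    qed
  qed
qed

lemma decomposed_exec:
  assumes M: "protocol_model M"
  shows "exec (decomposed M) st w st' \<Longrightarrow> simulates (pers M) st s \<Longrightarrow>
    \<exists>v s'. exec (msr_of M (protocol_rules M)) s v s' \<and> actions v = actions w"
proof (induction arbitrary: s rule: exec.induct)
  case (exec_Nil st)
  show ?case by (intro exI[of _ "[]"] exI[of _ s]) simp
next
  case (exec_Cons st a st1 w st2)
  obtain s1 where s1: "simulates (pers M) st1 s1"
    "a = silent \<and> s1 = s \<or> step (msr_of M (protocol_rules M)) s a s1"
    using decomposed_step[OF M exec_Cons.hyps(1) exec_Cons.prems] by blast
  obtain v s' where v: "exec (msr_of M (protocol_rules M)) s1 v s'" "actions v = actions w"
    using exec_Cons.IH[OF s1(1)] by blast
  from s1(2) show ?case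
  proof
    assume "a = silent \<and> s1 = s"
    with v show ?thesis by (intro exI[of _ v] exI[of _ s']) simp
  next
    assume "step (msr_of M (protocol_rules M)) s a s1"
    with v(1) have "exec (msr_of M (protocol_rules M)) s (a # v) s'"
      by (blast intro: exec.exec_Cons)
    moreover have "actions (a # v) = actions (a # w)"
      using v(2) by (cases a) auto
    ultimately show ?thesis by blast
  qed
qed

lemma decomposed_action_trace_incl:
  assumes "protocol_model M"
  shows "decomposed M \<preceq>\<^sub>t msr_of M (protocol_rules M)"
  unfolding action_trace_incl_def
proof clarify
  fix w assume "w \<in> traces (decomposed M)"
  then obtain st where "exec (decomposed M) (init (decomposed M)) w st"
    by (auto simp only: traces_def mem_Collect_eq)
  moreover have "simulates (pers M) (init (decomposed M)) ({#}, {})"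
    by (simp add: simulates_def split_beta exI[of _ "{}"])
  ultimately obtain v s where
    "exec (msr_of M (protocol_rules M)) ({#}, {}) v s" "actions v = actions w"
    using decomposed_exec[OF assms] by blast
  then show "actions w \<in> actions ` traces (msr_of M (protocol_rules M))"
    unfolding traces_def init_msr_of by (intro rev_image_eqI[of v]) (blast, simp)
qed


theorem theorem3:
  fixes M :: "('i, 'p, 'f) model"
    and ext' :: "'b \<Rightarrow> 'o"
    and ext :: "'o \<Rightarrow> ('i, 'p, 'f msg) sync"
    and act :: "'n::zero \<Rightarrow> ('i, 'p, 'f msg) fact multiset"
    and hoare :: "(('b, 'n) label \<Rightarrow> ('o, 'n) label) \<Rightarrow> 'asn \<Rightarrow> 'prog \<Rightarrow> 'asn \<Rightarrow> bool"
    and true :: 'asn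
    and permits :: "'asn \<Rightarrow> ('o, 'n) label list set"
    and sem :: "'prog \<Rightarrow> ('s, ('b, 'n) label) lts"
    and taint :: "'prog \<Rightarrow> ('src, 'b) taint_config \<Rightarrow> bool"
    and secrets :: "'prog \<Rightarrow> 'src set"
    and run_of :: "'prog \<Rightarrow> 'f msg"
    and \<delta> :: "'f msg \<Rightarrow> ('o, 'n) label list set"
    and \<psi> :: "'i \<Rightarrow> 'f msg \<Rightarrow> 'asn"
    and c :: "'i \<Rightarrow> 'f msg \<Rightarrow> 'prog"
    and \<sigma> :: "'i \<Rightarrow> 'f msg \<Rightarrow> ('src, 'b) taint_config"
    and E :: "('e, ('b, ('i, 'p, 'f msg) fact multiset) label) lts"
  assumes model: "protocol_model M"
    and act_empty: "act 0 = {#}"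
    and spec_sound: "\<And>i rid. rid \<in> runs M \<Longrightarrow>
          relabel (pi_int act \<circ> pi_ext ext) (lts_of (permits (\<psi> i rid)))
            \<preceq> msr_of M (role_run_rules M i rid)"
    and env_sound: "relabel (pi_ext ext \<circ> pi_ext ext') E \<preceq> msr_of M (env_ind_rules M)"
    and delta: "\<And>rid. rid \<in> runs M \<Longrightarrow>
          visible ` map (pi_int act \<circ> pi_ext ext) ` \<delta> rid
            = visible ` traces (msr_of M (ind_rules M rid))"
    and VA: "verifier_assumption hoare true permits sem taint secrets (ind_ops ext' ext) run_of \<delta>"
    and run: "\<And>i rid. rid \<in> runs M \<Longrightarrow> run_of (c i rid) = rid"
    and config: "\<And>i rid. rid \<in> runs M \<Longrightarrow>
          sources (\<sigma> i rid) = secrets (c i rid) \<and> sinks (\<sigma> i rid) = ind_ops ext' ext"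
    and taint_ok: "\<And>i rid. rid \<in> runs M \<Longrightarrow> taint (c i rid) (\<sigma> i rid)"
    and verified: "\<And>i rid. rid \<in> runs M \<Longrightarrow> hoare (pi_ext ext') (\<psi> i rid) (c i rid) true"
  shows "(Interleave (UNIV \<times> runs M) (\<lambda>(i, rid). relabel (pi_int act) (sem (c i rid)))
            \<parallel>\<^bsub>chi_impl ext' ext\<^esub> E)
         \<preceq>\<^sub>t msr_of M (protocol_rules M)"
proof -
  let ?conc = "pi_ext ext \<circ> pi_ext ext' :: ('b, ('i, 'p, 'f msg) fact multiset) label \<Rightarrow> _"
  let ?\<pi> = "pi_int act \<circ> pi_ext ext"
  have \<pi>0: "?\<pi> (Act 0) = Act 0"
    by (simp add: act_empty)
  have "relabel ?conc ((\<lambda>(i, rid). relabel (pi_int act) (sem (c i rid))) k)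
      \<preceq> (\<lambda>(i, rid). msr_of M (role_run_rules M i rid) ||| msr_of M (ind_rules M rid)) k"
    if k: "k \<in> UNIV \<times> runs M" for k :: "'i \<times> 'f msg"
  proof -
    obtain i rid where k_eq: "k = (i, rid)"
      by (rule prod.exhaust)
    with k have rid: "rid \<in> runs M" by simp
    have "relabel (pi_ext ext') (sem (c i rid)) \<preceq> (lts_of (permits (\<psi> i rid)) ||| lts_of (\<delta> rid))"
      using VA verified[OF rid] taint_ok[OF rid] config[OF rid] run[OF rid]
      unfolding verifier_assumption_def by metis
    then have "relabel ?\<pi> (relabel (pi_ext ext') (sem (c i rid)))
        \<preceq> (relabel ?\<pi> (lts_of (permits (\<psi> i rid))) ||| relabel ?\<pi> (lts_of (\<delta> rid)))"
      unfolding relabel_interleave[symmetric] by (rule trace_incl_relabel[of ?\<pi>, OF \<pi>0])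
    moreover have "relabel ?\<pi> (lts_of (\<delta> rid)) \<preceq> msr_of M (ind_rules M rid)"
      using delta[OF rid] by (intro trace_incl_lts_of[of ?\<pi>, OF \<pi>0]) simp
    ultimately have "relabel ?\<pi> (relabel (pi_ext ext') (sem (c i rid)))
        \<preceq> (msr_of M (role_run_rules M i rid) ||| msr_of M (ind_rules M rid))"
      using spec_sound[OF rid] trace_incl_interleave trace_incl_trans by blast
    \<comment> \<open>Internal and external relabelings act on different constructors. The verifier
      assumption relabels I/O first, whereas in the product the internal relabeling comes
      first.\<close>
    moreover have "?\<pi> \<circ> pi_ext ext' = ?conc \<circ> pi_int act"
      by (simp add: fun_eq_iff label.map_comp comp_def)
    ultimately show ?thesis
      by (simp only: k_eq prod.case relabel_relabel)
  qed
  \<comment> \<open>Both relabelings are \<open>?conc\<close>: \<open>chi_impl\<close> is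
    \<open>chi_plus\<close> applied to labels mapped by it.\<close>
  from action_trace_incl_sync_product[OF respects_silent_chi_plus this env_sound]
  have "(Interleave (UNIV \<times> runs M) (\<lambda>(i, rid). relabel (pi_int act) (sem (c i rid)))
      \<parallel>\<^bsub>chi_impl ext' ext\<^esub> E) \<preceq>\<^sub>t decomposed M"
    by (simp only: chi_impl_def[abs_def])
  then show ?thesis
    using decomposed_action_trace_incl[OF model] unfolding action_trace_incl_def by (rule subset_trans)
qed

end
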